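(* Let $r,n\ge 2$ be integers. Then there exist a discrete valuation domain $(R,pR)$ with finite residue field and valuation $\mathsf{v}$, and a primitive non-constant polynomial $f\in R[x]$ with $\mathsf{v}(\operatorname{d}(f))=n$, such that $F=\frac{f}{p^n}\in\operatorname{Int}(R)$ is irreducible but not absolutely irreducible in $\operatorname{Int}(R)$, every reduced fdp matrix of $f$ has rank $r$, and the minimal exponent $S\in\mathbb{N}$ for which $F^S$ does not factor uniquely in $\operatorname{Int}(R)$ satisfies (1) $S=(n+1)\big((n-1)^{r-1}+(n-1)^{r-2}\big)$, and (2) $S=(n+1)\min\{\|\mathbf{v}^+\|_\infty+\|\mathbf{v}^-\|_\infty\mid \mathbf{0}\neq\mathbf{v}\in\operatorname{fdk}(f)\cap\mathbb{Z}^{\mathcal{P}}\}$, where $\mathcal{P}$ is an irreducible divisor set of $f$.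
   Context: For a discrete valuation domain $(R,pR)$ with valuation $\mathsf{v}$ and quotient field $K$: $\operatorname{Int}(R)=\{F\in K[x]\mid F(R)\subseteq R\}$; for $f\in R[x]$, $\operatorname{d}(f)=\gcd(f(a)\mid a\in R)$, so $\mathsf{v}(\operatorname{d}(f))=\min_{a\in R}\mathsf{v}(f(a))$. An irreducible divisor set $\mathcal{P}$ of $f$ is a set of representatives of the associate classes of irreducible divisors of $f$ in $R[x]$. $\mathcal{W}(f)=\{a\in R\mid \mathsf{v}(f(a))=\mathsf{v}(\operatorname{d}(f))\}$ and $\operatorname{fdk}(f)=\{(u_g)\in\mathbb{Q}^{\mathcal{P}}\mid \forall a\in\mathcal{W}(f):\sum_g u_g\mathsf{v}(g(a))=0\}$. An fdp matrix of $f$ is a matrix $A\in\mathbb{Q}^{W\times\mathcal{P}}$, $W$ a finite set, with $\ker(A)=\operatorname{fdk}(f)$; it is reduced if its rows are $\mathbb{Q}$-linearly independent. For $\mathbf{u}\in\mathbb{Q}^{\mathcal{P}}$, $\mathbf{u}^+=\max(\mathbf{u},\mathbf{0})$, $\mathbf{u}^-=-\min(\mathbf{u},\mathbf{0})$ componentwise, and $\|\mathbf{u}\|_\infty=\max_g|u_g|$. An element factors uniquely if all its factorizations into irreducibles are essentially the same (same number of factors, pairwise associated after reindexing); an irreducible $r$ is absolutely irreducible if $r^k$ factors uniquely for all $k\in\mathbb{N}$. *)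

theory Defs
  imports Complex_Main "HOL-Computational_Algebra.Polynomial"
begin

definition subfield :: "'a::field set \<Rightarrow> bool" where
  "subfield K \<longleftrightarrow> 0 \<in> K \<and> 1 \<in> K \<and>
     (\<forall>x\<in>K. \<forall>y\<in>K. x + y \<in> K \<and> x * y \<in> K \<and> - x \<in> K) \<and>
     (\<forall>x\<in>K. x \<noteq> 0 \<longrightarrow> inverse x \<in> K)"

text \<open>(R, pR) is a discrete valuation domain with quotient field K, normalized discrete
  valuation v on K (values of v at 0 are irrelevant) and uniformizer p (v p = 1):
  R is the valuation ring of v.\<close>
definition dvr :: "'a::field set \<Rightarrow> 'a set \<Rightarrow> 'a \<Rightarrow> ('a \<Rightarrow> int) \<Rightarrow> bool" where
  "dvr K R p v \<longleftrightarrow> subfield K \<and> R \<subseteq> K \<and>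
     (\<forall>x\<in>K. \<forall>y\<in>K. x \<noteq> 0 \<longrightarrow> y \<noteq> 0 \<longrightarrow> v (x * y) = v x + v y) \<and>
     (\<forall>x\<in>K. \<forall>y\<in>K. x \<noteq> 0 \<longrightarrow> y \<noteq> 0 \<longrightarrow> x + y \<noteq> 0 \<longrightarrow> v (x + y) \<ge> min (v x) (v y)) \<and>
     R = {x\<in>K. x = 0 \<or> v x \<ge> 0} \<and>
     p \<in> R \<and> p \<noteq> 0 \<and> v p = 1 \<and>
     K = {a / b | a b. a \<in> R \<and> b \<in> R \<and> b \<noteq> 0}"

definition principal_ideal :: "'a::field set \<Rightarrow> 'a \<Rightarrow> 'a set" where
  "principal_ideal R p = {p * x | x. x \<in> R}"

definition finite_residue_field :: "'a::field set \<Rightarrow> 'a \<Rightarrow> bool" where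
  "finite_residue_field R p \<longleftrightarrow>
     finite {{b \<in> R. a - b \<in> principal_ideal R p} | a. a \<in> R}"

definition poly_ring :: "'a::field set \<Rightarrow> 'a poly set" where
  "poly_ring R = {f. \<forall>i. coeff f i \<in> R}"

definition int_val :: "'a::field set \<Rightarrow> 'a set \<Rightarrow> 'a poly set" where
  "int_val K R = {F. (\<forall>i. coeff F i \<in> K) \<and> (\<forall>a\<in>R. poly F a \<in> R)}"

definition primitive_poly :: "'a::field set \<Rightarrow> 'a \<Rightarrow> 'a poly \<Rightarrow> bool" where
  "primitive_poly R p f \<longleftrightarrow> \<not> (\<forall>i. coeff f i \<in> principal_ideal R p)"

definition unit_in :: "'b::comm_monoid_mult set \<Rightarrow> 'b \<Rightarrow> bool" where
  "unit_in S x \<longleftrightarrow> x \<in> S \<and> (\<exists>y\<in>S. x * y = 1)"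

definition dvd_in :: "'b::comm_monoid_mult set \<Rightarrow> 'b \<Rightarrow> 'b \<Rightarrow> bool" where
  "dvd_in S a b \<longleftrightarrow> a \<in> S \<and> b \<in> S \<and> (\<exists>c\<in>S. b = a * c)"

definition assoc_in :: "'b::comm_monoid_mult set \<Rightarrow> 'b \<Rightarrow> 'b \<Rightarrow> bool" where
  "assoc_in S a b \<longleftrightarrow> dvd_in S a b \<and> dvd_in S b a"

definition irred_in :: "'b::{comm_monoid_mult,zero} set \<Rightarrow> 'b \<Rightarrow> bool" where
  "irred_in S x \<longleftrightarrow> x \<in> S \<and> x \<noteq> 0 \<and> \<not> unit_in S x \<and>
     (\<forall>a\<in>S. \<forall>b\<in>S. x = a * b \<longrightarrow> unit_in S a \<or> unit_in S b)"

definition is_factorization_in :: "'b::{comm_monoid_mult,zero} set \<Rightarrow> 'b \<Rightarrow> 'b list \<Rightarrow> bool" where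
  "is_factorization_in S x fs \<longleftrightarrow> (\<forall>g\<in>set fs. irred_in S g) \<and> prod_list fs = x"

definition factors_uniquely_in :: "'b::{comm_monoid_mult,zero} set \<Rightarrow> 'b \<Rightarrow> bool" where
  "factors_uniquely_in S x \<longleftrightarrow>
     (\<forall>fs gs. is_factorization_in S x fs \<and> is_factorization_in S x gs \<longrightarrow>
        length fs = length gs \<and>
        (\<exists>\<sigma>. bij_betw \<sigma> {..<length fs} {..<length fs} \<and>
             (\<forall>i<length fs. assoc_in S (fs ! i) (gs ! \<sigma> i))))"

definition abs_irred_in :: "'b::{comm_monoid_mult,zero} set \<Rightarrow> 'b \<Rightarrow> bool" where
  "abs_irred_in S x \<longleftrightarrow> irred_in S x \<and> (\<forall>k::nat. factors_uniquely_in S (x ^ k))"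

definition irr_divisor_set :: "'b::{comm_monoid_mult,zero} set \<Rightarrow> 'b \<Rightarrow> 'b set \<Rightarrow> bool" where
  "irr_divisor_set S f P \<longleftrightarrow>
     (\<forall>g\<in>P. irred_in S g \<and> dvd_in S g f) \<and>
     (\<forall>g. irred_in S g \<and> dvd_in S g f \<longrightarrow> (\<exists>!h. h \<in> P \<and> assoc_in S g h))"

text \<open>v(d(f)) = min over a in R of v(f(a)) (values f(a) = 0 have valuation infinity).\<close>
definition vd :: "'a::field set \<Rightarrow> ('a \<Rightarrow> int) \<Rightarrow> 'a poly \<Rightarrow> nat" where
  "vd R v f = (LEAST k::nat. \<exists>a\<in>R. poly f a \<noteq> 0 \<and> v (poly f a) = int k)"

definition Wset :: "'a::field set \<Rightarrow> ('a \<Rightarrow> int) \<Rightarrow> 'a poly \<Rightarrow> 'a set" where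
  "Wset R v f = {a\<in>R. poly f a \<noteq> 0 \<and> v (poly f a) = int (vd R v f)}"

text \<open>Vectors in Q^P are functions vanishing outside P.\<close>
definition fdk :: "'a::field set \<Rightarrow> ('a \<Rightarrow> int) \<Rightarrow> 'a poly \<Rightarrow> 'a poly set \<Rightarrow> ('a poly \<Rightarrow> rat) set" where
  "fdk R v f P = {u. (\<forall>g. g \<notin> P \<longrightarrow> u g = 0) \<and>
     (\<forall>a\<in>Wset R v f. (\<Sum>g\<in>P. u g * of_int (v (poly g a))) = 0)}"

definition mat_kernel :: "'c set \<Rightarrow> 'd set \<Rightarrow> ('c \<Rightarrow> 'd \<Rightarrow> rat) \<Rightarrow> ('d \<Rightarrow> rat) set" where
  "mat_kernel W P A = {u. (\<forall>g. g \<notin> P \<longrightarrow> u g = 0) \<and> (\<forall>w\<in>W. (\<Sum>g\<in>P. A w g * u g) = 0)}"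

definition is_fdp_matrix :: "'a::field set \<Rightarrow> ('a \<Rightarrow> int) \<Rightarrow> 'a poly \<Rightarrow> 'a poly set \<Rightarrow>
    'c set \<Rightarrow> ('c \<Rightarrow> 'a poly \<Rightarrow> rat) \<Rightarrow> bool" where
  "is_fdp_matrix R v f P W A \<longleftrightarrow> finite W \<and> mat_kernel W P A = fdk R v f P"

definition rows_indep :: "'c set \<Rightarrow> 'd set \<Rightarrow> ('c \<Rightarrow> 'd \<Rightarrow> rat) \<Rightarrow> bool" where
  "rows_indep U P A \<longleftrightarrow>
     (\<forall>c. (\<forall>g\<in>P. (\<Sum>w\<in>U. c w * A w g) = 0) \<longrightarrow> (\<forall>w\<in>U. c w = 0))"

definition mat_rank :: "'c set \<Rightarrow> 'd set \<Rightarrow> ('c \<Rightarrow> 'd \<Rightarrow> rat) \<Rightarrow> nat" where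
  "mat_rank W P A = Max {card U | U. U \<subseteq> W \<and> rows_indep U P A}"

definition pos_norm :: "'d set \<Rightarrow> ('d \<Rightarrow> rat) \<Rightarrow> rat" where
  "pos_norm P u = Max (insert 0 ((\<lambda>g. max (u g) 0) ` P))"

definition neg_norm :: "'d set \<Rightarrow> ('d \<Rightarrow> rat) \<Rightarrow> rat" where
  "neg_norm P u = Max (insert 0 ((\<lambda>g. - min (u g) 0) ` P))"

end

theory Submission
  imports Defs "HOL-Computational_Algebra.Computational_Algebra" "HOL-Number_Theory.Cong"
begin

text \<open>
  Take \<open>K = \<rat>\<close> and \<open>R = \<int>\<close> localized at a prime \<open>q > 2r\<close>. The polynomial is
  \<open>f = g\<^sub>0 \<cdots> g\<^sub>r\<close>, where \<open>g\<^sub>i = \<Prod>\<^sub>c (x - 2c)\<^bsup>E(i,c)\<^esup> + 2q\<^bsup>n+2\<^esup>\<close> is Eisenstein at \<open>2\<close> and has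
  minimal valuation \<open>E(i,c)\<close> on the residue class of \<open>2c\<close>, simultaneously for all \<open>i\<close>. The columns of \<open>E\<close>
  are of three kinds: \<open>n\<close> at \<open>g\<^sub>0\<close>; \<open>n - 1\<close> at \<open>g\<^sub>j\<close> and \<open>1\<close> at \<open>g\<^sub>j\<^sub>+\<^sub>1\<close>, for \<open>1 \<le> j < r\<close>;
  and \<open>n + 1\<close> at a single \<open>g\<^sub>j\<close>, for \<open>1 \<le> j \<le> r\<close>. The first two kinds are the rows of an fdp matrix
  of rank \<open>r\<close>, whose kernel is spanned by \<open>(0, a\<^sub>1, \<dots>, a\<^sub>r)\<close> with \<open>a\<^sub>j = \<plusminus>(n-1)\<^bsup>j-1\<^esup>\<close> of alternating sign.

  A divisor of a power of \<open>F\<close> in \<open>Int(R)\<close> has valuation \<open>0\<close> at all classes of the first two kinds, so up to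
  units it is \<open>q\<^bsup>-ns\<^esup> g\<^sub>0\<^bsup>s\<^esup> \<Prod>\<^sub>j g\<^sub>j\<^bsup>s + t a\<^sub>j\<^esup>\<close> for integers \<open>s, t\<close>, and the classes of the third kind require
  \<open>s + (n+1) t a\<^sub>j \<ge> 0\<close>. Hence \<open>F\<close> is the point \<open>(1, 0)\<close> of a plane cone, and a factorization of
  \<open>F\<^sup>k\<close> other than \<open>F \<cdots> F\<close> needs points with \<open>t > 0\<close> and with \<open>t < 0\<close>, the cheapest of which lie on the two
  boundary rays at \<open>t = \<plusminus>1\<close> and have \<open>s\<close>-coordinates \<open>(n+1)(n-1)\<^bsup>r-2\<^esup>\<close> and \<open>(n+1)(n-1)\<^bsup>r-1\<^esup>\<close>.
\<close>

section \<open>Linear algebra over index sets\<close>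

text \<open>Gaussian elimination, one row at a time: a pivot \<open>g0\<close> in row
  \<open>w\<close> clears its column from the other rows, giving \<open>B\<close>; induction solves
  the smaller system over \<open>P - {g0}\<close>, and row \<open>w\<close> then dictates the value
  at \<open>g0\<close>.\<close>

lemma homogeneous_solution:
  fixes A :: "'c \<Rightarrow> 'd \<Rightarrow> rat"
  assumes "finite W" "finite P" "card W < card P"
  shows "\<exists>u. (\<forall>g. g \<notin> P \<longrightarrow> u g = 0) \<and> u \<noteq> (\<lambda>_. 0) \<and> (\<forall>w\<in>W. (\<Sum>g\<in>P. A w g * u g) = 0)"
  using assms
proof (induction W arbitrary: P A rule: finite_induct)
  case empty
  then obtain g0 where "g0 \<in> P" by fastforce
  then show ?case
    by (intro exI[of _ "\<lambda>g. if g = g0 then 1 else 0"]) (auto simp: fun_eq_iff)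
next
  case (insert w W)
  show ?case
  proof (cases "\<forall>g\<in>P. A w g = 0")
    case True
    have "card W < card P" using insert by simp
    from insert.IH[OF insert.prems(1) this, of A] True show ?thesis by auto
  next
    case False
    then obtain g0 where g0: "g0 \<in> P" "A w g0 \<noteq> 0" by blast
    define Q where "Q = P - {g0}"
    define B where "B w' g = A w' g - A w' g0 * A w g / A w g0" for w' g
    have Q: "finite Q" "card W < card Q" "g0 \<notin> Q" "P = insert g0 Q"
      using insert g0 by (auto simp: Q_def)
    obtain u where u: "\<forall>g. g \<notin> Q \<longrightarrow> u g = 0" "u \<noteq> (\<lambda>_. 0)"
      "\<forall>w'\<in>W. (\<Sum>g\<in>Q. B w' g * u g) = 0"
      using insert.IH[OF Q(1,2), of B] by blast
    define c where "c = - (\<Sum>g\<in>Q. A w g * u g) / A w g0"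
    have eq: "(\<Sum>g\<in>P. A w' g * (u(g0 := c)) g) = A w' g0 * c + (\<Sum>g\<in>Q. A w' g * u g)" for w'
    proof -
      have "(\<Sum>g\<in>Q. A w' g * (u(g0 := c)) g) = (\<Sum>g\<in>Q. A w' g * u g)"
        using Q(3) by (intro sum.cong) auto
      then show ?thesis using Q by simp
    qed
    have "(\<Sum>g\<in>P. A w' g * (u(g0 := c)) g) = 0" if "w' \<in> W" for w'
    proof -
      have "0 = (\<Sum>g\<in>Q. B w' g * u g)" using u(3) that by simp
      also have "\<dots> = (\<Sum>g\<in>Q. A w' g * u g) - (\<Sum>g\<in>Q. A w' g0 / A w g0 * (A w g * u g))"
        by (simp add: B_def left_diff_distrib sum_subtractf mult.assoc)
      also have "(\<Sum>g\<in>Q. A w' g0 / A w g0 * (A w g * u g)) = - (A w' g0 * c)"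
        unfolding c_def sum_distrib_left[symmetric] by simp
      finally show ?thesis using eq[of w'] by simp
    qed
    moreover have "(\<Sum>g\<in>P. A w g * (u(g0 := c)) g) = 0"
      using eq[of w] g0(2) by (simp add: c_def)
    moreover have "u(g0 := c) \<noteq> (\<lambda>_. 0)"
    proof
      assume "u(g0 := c) = (\<lambda>_. 0)"
      then have "u g = 0" if "g \<noteq> g0" for g using that by (metis fun_upd_apply)
      then have "u = (\<lambda>_. 0)" using u(1) Q(3) by (metis)
      then show False using u(2) by simp
    qed
    moreover have "\<forall>g. g \<notin> P \<longrightarrow> (u(g0 := c)) g = 0"
      using u(1) g0(1) Q(4) by auto
    ultimately show ?thesis by blast
  qed
qed

lemma mat_rank_rows_indep:
  assumes "finite W" "rows_indep W P A"
  shows "mat_rank W P A = card W"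
proof -
  have "finite {card U | U. U \<subseteq> W \<and> rows_indep U P A}"
    using assms(1) by (rule_tac finite_subset[of _ "card ` Pow W"]) auto
  then show ?thesis unfolding mat_rank_def
    using assms by (intro Max_eqI) (auto intro: card_mono)
qed

text \<open>Rank-nullity for a kernel spanned by \<open>b\<close>, by counting rows against
  \<open>P - {z}\<close>. With too few rows some nonzero kernel vector vanishes at \<open>z\<close>,
  which no nonzero multiple of \<open>b\<close> does. With too many rows there is a linear relation
  among them outside column \<open>z\<close>, and the vector \<open>b\<close> extends it to that
  column.\<close>

lemma rank_nullity_line:
  fixes A :: "'c \<Rightarrow> 'd \<Rightarrow> rat"
  assumes fin: "finite W" "finite P" and indep: "rows_indep W P A"
    and z: "z \<in> P" "b z \<noteq> 0"
    and ker: "mat_kernel W P A = {\<lambda>g. t * b g | t. True}"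
  shows "card W + 1 = card P"
proof (rule ccontr)
  assume "card W + 1 \<noteq> card P"
  then consider "card W < card (P - {z})" | "card (P - {z}) < card W"
    using card.remove[OF fin(2) z(1)] by linarith
  then show False
  proof cases
    case 1
    obtain u where u: "\<forall>g. g \<notin> P - {z} \<longrightarrow> u g = 0" "u \<noteq> (\<lambda>_. 0)"
      "\<forall>w\<in>W. (\<Sum>g\<in>P - {z}. A w g * u g) = 0"
      using homogeneous_solution[OF fin(1) _ 1, of A] fin by auto
    have "(\<Sum>g\<in>P. A w g * u g) = (\<Sum>g\<in>P - {z}. A w g * u g)" for w
      using u(1) fin by (intro sum.mono_neutral_right) auto
    with u have "u \<in> mat_kernel W P A" by (auto simp: mat_kernel_def)
    then obtain t where t: "u = (\<lambda>g. t * b g)" using ker by auto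
    have "u z = 0" using u(1) by simp
    with t z have "t = 0" by auto
    with t u(2) show False by simp
  next
    case 2
    obtain c where c: "\<forall>w. w \<notin> W \<longrightarrow> c w = 0" "c \<noteq> (\<lambda>_. 0)"
      "\<forall>g\<in>P - {z}. (\<Sum>w\<in>W. A w g * c w) = 0"
      using homogeneous_solution[OF _ fin(1) 2, of "\<lambda>g w. A w g"] fin by auto
    have "b \<in> mat_kernel W P A" unfolding ker by (auto intro: exI[of _ 1])
    then have b: "(\<Sum>g\<in>P. A w g * b g) = 0" if "w \<in> W" for w
      using that by (auto simp: mat_kernel_def)
    \<comment> \<open>Pairing the relation \<open>c\<close> with the kernel vector \<open>b\<close>
      kills all columns but \<open>z\<close>; as \<open>b z\<close> is nonzero, \<open>c\<close> is
      a relation in column \<open>z\<close> as well.\<close>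
    have "0 = (\<Sum>w\<in>W. c w * (\<Sum>g\<in>P. A w g * b g))" using b by simp
    also have "\<dots> = (\<Sum>g\<in>P. b g * (\<Sum>w\<in>W. A w g * c w))"
      unfolding sum_distrib_left by (subst sum.swap) (simp add: mult_ac)
    also have "\<dots> = b z * (\<Sum>w\<in>W. A w z * c w)"
      using fin z c(3) by (subst sum.remove[of P z]) auto
    finally have "(\<Sum>w\<in>W. A w z * c w) = 0" using z by simp
    with c(3) have "\<forall>g\<in>P. (\<Sum>w\<in>W. c w * A w g) = 0" by (auto simp: mult.commute)
    with indep have "\<forall>w\<in>W. c w = 0" by (auto simp: rows_indep_def)
    with c(1,2) show False by (auto simp: fun_eq_iff)
  qed
qed

section \<open>The exponent pattern\<close>

text \<open>Column \<open>0\<close> is repeated for all \<open>c\<close> from \<open>2 * r\<close>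
  on, so the table covers the residue classes of any prime above \<open>2 * r\<close>. The column
  sums are \<open>n\<close>, except \<open>n + 1\<close> for the columns from \<open>r\<close> to
  \<open>2 * r - 1\<close>: these miss the fixed divisor and only limit which divisors of powers of
  \<open>F\<close> are integer-valued.\<close>

definition expo :: "nat \<Rightarrow> nat \<Rightarrow> nat \<Rightarrow> nat \<Rightarrow> nat" where
  "expo r n i c =
    (if 1 \<le> c \<and> c < r then (if i = c then n - 1 else if i = c + 1 then 1 else 0)
     else if r \<le> c \<and> c < 2 * r then (if i = c - r + 1 then n + 1 else 0)
     else if i = 0 then n else 0)"

text \<open>The solution, up to scaling, of the recurrence
  \<open>(n - 1) * w j + w (j + 1) = 0\<close> on the indices from \<open>1\<close> to
  \<open>r\<close>, with the sign chosen so that the entry at \<open>r\<close> is positive. The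
  kernel vector has entry \<open>0\<close> at index \<open>0\<close>, which is not the value of this
  formula there.\<close>

definition alt :: "nat \<Rightarrow> nat \<Rightarrow> nat \<Rightarrow> int" where
  "alt r n i = (-1) ^ (r - i) * (int n - 1) ^ (i - 1)"

lemma expo_le: "expo r n i c \<le> n + 1"
  unfolding expo_def by auto

text \<open>The column sums turn the valuation of a product of powers on a residue class into a
  linear form in the exponents. The semiring is left open because the weights are integer exponents
  in one use and rational kernel vectors in another.\<close>

lemma sum_expo_chain:
  fixes w :: "nat \<Rightarrow> 'b::comm_semiring_1"
  assumes "1 \<le> c" "c < r"
  shows "(\<Sum>i\<le>r. w i * of_nat (expo r n i c)) = of_nat (n - 1) * w c + w (c + 1)"
proof -
  have "(\<Sum>i\<le>r. w i * of_nat (expo r n i c)) =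
      (\<Sum>i\<in>{c, c + 1}. w i * of_nat (expo r n i c))"
    using assms by (intro sum.mono_neutral_right) (auto simp: expo_def)
  then show ?thesis using assms by (simp add: expo_def mult.commute)
qed

lemma sum_expo_single:
  fixes w :: "nat \<Rightarrow> 'b::comm_semiring_1"
  assumes "1 \<le> j" "j \<le> r"
  shows "(\<Sum>i\<le>r. w i * of_nat (expo r n i (r - 1 + j))) = of_nat (n + 1) * w j"
proof -
  have "r \<le> r - 1 + j" "r - 1 + j < 2 * r" "r - 1 + j - r + 1 = j" using assms by auto
  then have "expo r n i (r - 1 + j) = (if i = j then n + 1 else 0)" for i
    by (simp add: expo_def)
  then have "(\<Sum>i\<le>r. w i * of_nat (expo r n i (r - 1 + j))) =
      (\<Sum>i\<in>{j}. w i * of_nat (n + 1))"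
    using assms by (intro sum.mono_neutral_cong_right) auto
  then show ?thesis by (simp add: mult.commute)
qed

lemma sum_expo_other:
  fixes w :: "nat \<Rightarrow> 'b::comm_semiring_1"
  assumes "c = 0 \<or> c \<ge> 2 * r" "r \<ge> 1"
  shows "(\<Sum>i\<le>r. w i * of_nat (expo r n i c)) = of_nat n * w 0"
proof -
  have "(\<Sum>i\<le>r. w i * of_nat (expo r n i c)) = (\<Sum>i\<in>{0}. w i * of_nat (expo r n i c))"
    using assms by (intro sum.mono_neutral_right) (auto simp: expo_def)
  then show ?thesis using assms by (auto simp: expo_def mult.commute)
qed

lemma expo_class_cases:
  fixes r c :: nat
  assumes "r \<ge> 1"
  obtains "c = 0 \<or> c \<ge> 2 * r" | "1 \<le> c" "c < r"
    | j where "1 \<le> j" "j \<le> r" "c = r - 1 + j"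
proof (cases "c = 0 \<or> c \<ge> 2 * r \<or> (1 \<le> c \<and> c < r)")
  case False
  with assms have "1 \<le> c + 1 - r" "c + 1 - r \<le> r" "c = r - 1 + (c + 1 - r)" by auto
  then show thesis using that(3) by blast
qed (use that in auto)

lemma alt_Suc:
  assumes "1 \<le> j" "j < r"
  shows "alt r n (j + 1) = - (int n - 1) * alt r n j"
proof -
  obtain k where "j = Suc k" using assms by (cases j) auto
  moreover have "r - j = Suc (r - (j + 1))" using assms by simp
  ultimately show ?thesis by (simp add: alt_def algebra_simps)
qed

lemma alt_top: "alt r n r = (int n - 1) ^ (r - 1)"
  by (simp add: alt_def)

lemma alt_below_top: "r \<ge> 2 \<Longrightarrow> alt r n (r - 1) = - ((int n - 1) ^ (r - 2))"
  by (simp add: alt_def numeral_2_eq_2)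

lemma alt_one_abs: "\<bar>alt r n 1\<bar> = 1"
  by (simp add: alt_def abs_mult power_abs)

text \<open>The sign is the parity of \<open>r - i\<close>. Positive entries are powers with
  exponent at most \<open>r - 1\<close>; a negative entry has \<open>i\<close> different from
  \<open>r\<close>, so its exponent is at most \<open>r - 2\<close>.\<close>

lemma alt_bounds:
  assumes "n \<ge> 2" "r \<ge> 2" "1 \<le> i" "i \<le> r"
  shows "alt r n i \<le> (int n - 1) ^ (r - 1)" "- ((int n - 1) ^ (r - 2)) \<le> alt r n i"
proof -
  have n1: "1 \<le> int n - 1" using assms by simp
  have pos: "0 \<le> (int n - 1) ^ k" for k using n1 by simp
  have mono: "(int n - 1) ^ (i - 1) \<le> (int n - 1) ^ (r - 1)"
    using assms n1 by (intro power_increasing) auto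
  have "alt r n i \<le> (int n - 1) ^ (r - 1) \<and> - ((int n - 1) ^ (r - 2)) \<le> alt r n i"
  proof (cases "even (r - i)")
    case True
    then have "alt r n i = (int n - 1) ^ (i - 1)" by (simp add: alt_def)
    with mono pos[of "i - 1"] pos[of "r - 2"] show ?thesis by linarith
  next
    case False
    then have "i \<noteq> r" by auto
    then have "(int n - 1) ^ (i - 1) \<le> (int n - 1) ^ (r - 2)"
      using assms n1 by (intro power_increasing) auto
    moreover from False have "alt r n i = - ((int n - 1) ^ (i - 1))" by (simp add: alt_def)
    ultimately show ?thesis using pos[of "i - 1"] pos[of "r - 1"] by linarith
  qed
  then show "alt r n i \<le> (int n - 1) ^ (r - 1)" "- ((int n - 1) ^ (r - 2)) \<le> alt r n i"
    by auto
qed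

text \<open>The recurrence propagates from \<open>w 1\<close>. Since \<open>alt r n 1\<close> is a
  sign, it is its own inverse, so the scaling factor is found without division and is an integer
  when \<open>w\<close> is integral.\<close>

lemma alt_recurrence_unique:
  fixes w :: "nat \<Rightarrow> 'b::comm_ring_1"
  assumes rec: "\<And>j. 1 \<le> j \<Longrightarrow> j < r \<Longrightarrow> of_nat (n - 1) * w j + w (j + 1) = 0" and n: "n \<ge> 1"
    and i: "1 \<le> i" "i \<le> r"
  shows "w i = of_int (alt r n 1) * w 1 * of_int (alt r n i)"
  using i
proof (induction i rule: nat_induct_at_least)
  case base
  have "alt r n 1 * alt r n 1 = 1"
    using alt_one_abs[of r n] by (metis abs_mult_self_eq mult_1)
  then have "of_int (alt r n 1) * of_int (alt r n 1) = (1::'b)"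
    by (metis of_int_1 of_int_mult)
  then show ?case by (simp add: mult_ac)
next
  case (Suc m)
  have "w (m + 1) = - (of_nat (n - 1) * w m)"
    using rec[of m] Suc.prems Suc.hyps by (simp add: eq_neg_iff_add_eq_0 add.commute)
  also have "\<dots> = - (of_int (int n - 1) * w m)"
    using n by (simp add: of_nat_diff)
  also have "\<dots> = of_int (alt r n 1) * w 1 * of_int (alt r n (m + 1))"
  proof -
    have "alt r n (m + 1) = - (int n - 1) * alt r n m" using Suc alt_Suc[of m r n] by simp
    then have "of_int (alt r n (m + 1)) = (- of_int (int n - 1) * of_int (alt r n m) :: 'b)"
      by (metis of_int_minus of_int_mult)
    moreover have "w m = of_int (alt r n 1) * w 1 * of_int (alt r n m)" using Suc by simp
    ultimately show ?thesis by (simp only: mult_minus_left mult_minus_right mult_ac)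
  qed
  finally show ?case by simp
qed

section \<open>Valuation rings and polynomials over them\<close>

text \<open>Closure under sums and products is what evaluation and multiplication of polynomials
  call for; one notion serves \<open>K\<close>, \<open>R\<close>, the polynomial rings over them and
  \<open>int_val K R\<close>.\<close>

definition subsemiring :: "'b::comm_semiring_1 set \<Rightarrow> bool" where
  "subsemiring S \<longleftrightarrow> 0 \<in> S \<and> 1 \<in> S \<and> (\<forall>x\<in>S. \<forall>y\<in>S. x + y \<in> S \<and> x * y \<in> S)"

lemma subsemiringD:
  assumes "subsemiring S"
  shows "0 \<in> S" "1 \<in> S" "x \<in> S \<Longrightarrow> y \<in> S \<Longrightarrow> x + y \<in> S" "x \<in> S \<Longrightarrow> y \<in> S \<Longrightarrow> x * y \<in> S"
  using assms by (auto simp: subsemiring_def)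

lemma subsemiring_sum:
  assumes "subsemiring S" "\<And>i. i \<in> A \<Longrightarrow> h i \<in> S"
  shows "sum h A \<in> S"
  using assms(2)
  by (induction A rule: infinite_finite_induct) (auto intro: subsemiringD[OF assms(1)])

lemma subsemiring_prod:
  assumes "subsemiring S" "\<And>i. i \<in> A \<Longrightarrow> h i \<in> S"
  shows "prod h A \<in> S"
  using assms(2)
  by (induction A rule: infinite_finite_induct) (auto intro: subsemiringD[OF assms(1)])

lemma subsemiring_power:
  assumes "subsemiring S" "x \<in> S"
  shows "x ^ k \<in> S"
  by (induction k) (auto intro: subsemiringD[OF assms(1)] assms(2))

lemma subsemiring_prod_list:
  assumes "subsemiring S" "set xs \<subseteq> S"
  shows "prod_list xs \<in> S"
  using assms(2) by (induction xs) (auto intro: subsemiringD[OF assms(1)])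

lemma poly_ring_smult: "subsemiring S \<Longrightarrow> c \<in> S \<Longrightarrow> h \<in> poly_ring S \<Longrightarrow> smult c h \<in> poly_ring S"
  by (auto simp: poly_ring_def intro: subsemiringD)

lemma subsemiring_poly_ring:
  assumes "subsemiring S"
  shows "subsemiring (poly_ring S)"
proof -
  note S = subsemiringD[OF assms]
  have "coeff (x * y) i \<in> S" if "x \<in> poly_ring S" "y \<in> poly_ring S" for x y i
    unfolding coeff_mult using that
    by (intro subsemiring_sum[OF assms]) (auto simp: poly_ring_def intro: S)
  then show ?thesis
    by (auto simp: subsemiring_def poly_ring_def coeff_1 intro: S)
qed

lemma poly_ring_eval:
  assumes "subsemiring S" "h \<in> poly_ring S" "a \<in> S"
  shows "poly h a \<in> S"
  unfolding poly_altdef using assms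
  by (intro subsemiring_sum subsemiringD(4)[OF assms(1)] subsemiring_power) (auto simp: poly_ring_def)

locale valuation =
  fixes K R :: "'a::field set" and p :: 'a and v :: "'a \<Rightarrow> int"
  assumes dvr: "dvr K R p v"
begin

lemma dvr_parts:
  shows "subfield K"
    and "\<forall>x\<in>K. \<forall>y\<in>K. x \<noteq> 0 \<longrightarrow> y \<noteq> 0 \<longrightarrow> v (x * y) = v x + v y"
    and "\<forall>x\<in>K. \<forall>y\<in>K. x \<noteq> 0 \<longrightarrow> y \<noteq> 0 \<longrightarrow> x + y \<noteq> 0 \<longrightarrow> v (x + y) \<ge> min (v x) (v y)"
    and "R = {x \<in> K. x = 0 \<or> v x \<ge> 0}" and "p \<in> R" and "p \<noteq> 0" and "v p = 1"
  by (insert dvr, unfold dvr_def, (elim conjE, assumption)+)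

lemma in_R_iff: "x \<in> R \<longleftrightarrow> x \<in> K \<and> (x = 0 \<or> 0 \<le> v x)"
  by (subst dvr_parts(4)) simp

lemma R_sub_K: "x \<in> R \<Longrightarrow> x \<in> K"
  by (simp add: in_R_iff)

lemma subsemiring_K: "subsemiring K"
  using dvr_parts(1) by (auto simp: subfield_def subsemiring_def)

lemmas K_closed = subsemiringD[OF subsemiring_K]

lemma K_inverse: "x \<in> K \<Longrightarrow> inverse x \<in> K"
  using dvr_parts(1) by (cases "x = 0") (auto simp: subfield_def)

lemma K_divide: "x \<in> K \<Longrightarrow> y \<in> K \<Longrightarrow> x / y \<in> K"
  by (simp add: divide_inverse K_closed K_inverse)

lemma p_K: "p \<in> K" and p_nz: "p \<noteq> 0" and v_p: "v p = 1"
  using dvr_parts(5-7) R_sub_K by auto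

lemma v_mult: "x \<in> K \<Longrightarrow> y \<in> K \<Longrightarrow> x \<noteq> 0 \<Longrightarrow> y \<noteq> 0 \<Longrightarrow> v (x * y) = v x + v y"
  using dvr_parts(2) by blast

lemma v_1: "v 1 = 0"
  using v_mult[of 1 1] by (simp add: K_closed)

lemma v_power: "x \<in> K \<Longrightarrow> x \<noteq> 0 \<Longrightarrow> v (x ^ k) = int k * v x"
  by (induction k) (auto simp: v_1 v_mult subsemiring_power[OF subsemiring_K] algebra_simps)

lemma v_prod:
  assumes "\<And>i. i \<in> A \<Longrightarrow> h i \<in> K" "\<And>i. i \<in> A \<Longrightarrow> h i \<noteq> 0"
  shows "v (prod h A) = (\<Sum>i\<in>A. v (h i))"
  using assms
proof (induction A rule: infinite_finite_induct)
  case (insert i A)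
  then show ?case
    by (auto simp: v_mult subsemiring_prod[OF subsemiring_K])
qed (auto simp: v_1)

lemma v_inverse: "x \<in> K \<Longrightarrow> x \<noteq> 0 \<Longrightarrow> v (1 / x) = - v x"
  using v_mult[of x "1 / x"] K_divide[OF K_closed(2), of x] v_1 by simp

lemma subsemiring_R: "subsemiring R"
proof -
  have "x + y \<in> R" if "x \<in> R" "y \<in> R" for x y
  proof (cases "x = 0 \<or> y = 0 \<or> x + y = 0")
    case False
    with that have "v (x + y) \<ge> min (v x) (v y)"
      using dvr_parts(3) R_sub_K by blast
    with that False show ?thesis by (auto simp: in_R_iff K_closed)
  qed (use that in \<open>auto simp: in_R_iff K_closed\<close>)
  moreover have "x * y \<in> R" if "x \<in> R" "y \<in> R" for x y
    using that by (cases "x = 0 \<or> y = 0") (auto simp: in_R_iff K_closed v_mult)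
  ultimately show ?thesis
    by (auto simp: subsemiring_def in_R_iff K_closed v_1)
qed

lemmas R_closed = subsemiringD[OF subsemiring_R]

lemma poly_ring_R_sub_K: "h \<in> poly_ring R \<Longrightarrow> h \<in> poly_ring K"
  by (auto simp: poly_ring_def R_sub_K)

lemma int_val_iff: "h \<in> int_val K R \<longleftrightarrow> h \<in> poly_ring K \<and> (\<forall>a\<in>R. poly h a \<in> R)"
  by (auto simp: int_val_def poly_ring_def)

lemma subsemiring_int_val: "subsemiring (int_val K R)"
proof -
  note P = subsemiringD[OF subsemiring_poly_ring[OF subsemiring_K]]
  show ?thesis unfolding subsemiring_def
    by (simp add: int_val_iff P R_closed)
qed

lemmas int_val_closed = subsemiringD[OF subsemiring_int_val]

lemma int_val_const: "c \<in> R \<Longrightarrow> [:c:] \<in> int_val K R"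
  by (auto simp: int_val_def coeff_pCons R_sub_K K_closed split: nat.split)

lemma int_val_smult: "c \<in> R \<Longrightarrow> h \<in> int_val K R \<Longrightarrow> smult c h \<in> int_val K R"
  using int_val_closed(4)[OF int_val_const, of c h] by simp

lemma assoc_smult_unit:
  assumes "c \<in> K" "c \<noteq> 0" "v c = 0" "h \<in> int_val K R"
  shows "assoc_in (int_val K R) h (smult c h)"
proof -
  have c: "c \<in> R" "1 / c \<in> R"
    using assms by (auto simp: in_R_iff v_inverse K_divide K_closed)
  have "smult c h = h * [:c:]" "h = smult c h * [:1 / c:]" using assms by auto
  then show ?thesis unfolding assoc_in_def dvd_in_def
    using int_val_smult[OF c(1) assms(4)] assms(4) int_val_const[OF c(1)] int_val_const[OF c(2)]
    by blast
qed

end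

lemma dvd_in_trans:
  assumes "subsemiring S" "dvd_in S a b" "dvd_in S b c"
  shows "dvd_in S a c"
proof -
  obtain x y where "x \<in> S" "b = a * x" "y \<in> S" "c = b * y"
    using assms(2,3) by (auto simp: dvd_in_def)
  then have "c = a * (x * y)" "x * y \<in> S"
    by (simp_all add: mult_ac subsemiringD(4)[OF assms(1)])
  with assms show ?thesis by (auto simp: dvd_in_def)
qed

lemma assoc_in_trans:
  assumes "subsemiring S" "assoc_in S a b" "assoc_in S b c"
  shows "assoc_in S a c"
  using assms(2,3) unfolding assoc_in_def by (blast intro: dvd_in_trans[OF assms(1)])

lemma assoc_in_sym: "assoc_in S a b \<Longrightarrow> assoc_in S b a"
  by (simp add: assoc_in_def)

section \<open>Polynomials with a prescribed valuation pattern\<close>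

lemma sum_list_pos_ge_one:
  fixes h :: "'b \<Rightarrow> int"
  shows "x \<in> set xs \<Longrightarrow> h x > 0 \<Longrightarrow> 1 \<le> sum_list (map (\<lambda>x. max (h x) 0) xs)"
proof (induction xs)
  case (Cons y ys)
  have "0 \<le> sum_list (map (\<lambda>x. max (h x) 0) ys)" by (intro sum_list_nonneg) auto
  with Cons show ?case by (auto simp: max_def)
qed simp

text \<open>The interface between arithmetic and combinatorics. \<open>cover\<close> bounds all
  \<open>g i\<close> at a point from below by one common column, \<open>v_pt\<close> realizes each
  of the first \<open>2 * r\<close> columns exactly, and \<open>divisors\<close> is unique
  factorization over \<open>K\<close> of the powers of the product.\<close>

locale pattern = valuation K R p v for K R :: "'a::field set" and p v +
  fixes g :: "nat \<Rightarrow> 'a poly" and pt :: "nat \<Rightarrow> 'a" and r n :: nat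
  assumes r: "r \<ge> 2" and n: "n \<ge> 2"
    and g_R: "\<And>i. i \<le> r \<Longrightarrow> g i \<in> poly_ring R"
    and g_monic: "\<And>i. i \<le> r \<Longrightarrow> lead_coeff (g i) = 1"
    and g_degree: "\<And>i. i \<le> r \<Longrightarrow> degree (g i) > 0"
    and g_nz: "\<And>i a. i \<le> r \<Longrightarrow> a \<in> R \<Longrightarrow> poly (g i) a \<noteq> 0"
    and cover: "\<And>a. a \<in> R \<Longrightarrow> \<exists>c. \<forall>i\<le>r. int (expo r n i c) \<le> v (poly (g i) a)"
    and pt_R: "\<And>c. c < 2 * r \<Longrightarrow> pt c \<in> R"
    and v_pt: "\<And>i c. i \<le> r \<Longrightarrow> c < 2 * r \<Longrightarrow> v (poly (g i) (pt c)) = int (expo r n i c)"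
    and divisors: "\<And>x y c k. x \<in> poly_ring K \<Longrightarrow> y \<in> poly_ring K \<Longrightarrow> c \<in> K \<Longrightarrow> c \<noteq> 0 \<Longrightarrow>
      x * y = smult c ((\<Prod>i\<le>r. g i) ^ k) \<Longrightarrow>
      \<exists>d e. d \<in> K \<and> d \<noteq> 0 \<and> x = smult d (\<Prod>i\<le>r. g i ^ e i)"
begin

section \<open>Products of powers of the \<open>g i\<close> and their valuations\<close>

abbreviation IntR where "IntR \<equiv> int_val K R"

definition f where "f = (\<Prod>i\<le>r. g i)"
definition F where "F = smult (1 / p ^ n) f"
definition G where "G e = (\<Prod>i\<le>r. g i ^ e i)"

abbreviation al :: "nat \<Rightarrow> int" where "al \<equiv> alt r n"
text \<open>\<open>M\<close> and \<open>- M'\<close> are the largest and the smallest entry of the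
  kernel vector, at the indices \<open>r\<close> and \<open>r - 1\<close>; they give the slopes of
  the two boundary rays of the cone.\<close>

definition M where "M = (int n - 1) ^ (r - 1)"
definition M' where "M' = (int n - 1) ^ (r - 2)"

lemma M_ge: "M \<ge> 1" "M' \<ge> 1"
  using n by (auto simp: M_def M'_def)

lemma al_bounds: "1 \<le> i \<Longrightarrow> i \<le> r \<Longrightarrow> al i \<le> M \<and> - M' \<le> al i"
  using alt_bounds[OF n r] by (auto simp: M_def M'_def)

lemma al_top: "al r = M" and al_below: "al (r - 1) = - M'"
  by (simp_all only: M_def M'_def alt_top alt_below_top[OF r])

lemma f_eq_G: "f = G (\<lambda>_. 1)"
  by (simp add: f_def G_def)

lemma G_0: "G (\<lambda>_. 0) = 1"
  by (simp add: G_def)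

lemma G_add: "G (\<lambda>i. e i + e' i) = G e * G e'"
  by (simp add: G_def power_add prod.distrib)

lemma G_power: "G e ^ k = G (\<lambda>i. k * e i)"
  by (simp add: G_def prod_power_distrib power_mult[symmetric] mult.commute)

lemma G_cong: "(\<And>i. i \<le> r \<Longrightarrow> e i = e' i) \<Longrightarrow> G e = G e'"
  by (simp add: G_def)

lemma G_R: "G e \<in> poly_ring R"
  unfolding G_def using subsemiring_poly_ring[OF subsemiring_R] g_R
  by (intro subsemiring_prod subsemiring_power) auto

lemma G_monic: "lead_coeff (G e) = 1"
  by (simp add: G_def lead_coeff_prod lead_coeff_power g_monic)

lemma G_nz: "G e \<noteq> 0"
  using G_monic[of e] by auto

lemma G_eval_K: "a \<in> R \<Longrightarrow> poly (G e) a \<in> R"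
  using poly_ring_eval[OF subsemiring_R G_R] .

lemma g_eval_K: "i \<le> r \<Longrightarrow> a \<in> R \<Longrightarrow> poly (g i) a \<in> K"
  using poly_ring_eval[OF subsemiring_R g_R] R_sub_K by blast

lemma G_eval_nz: "a \<in> R \<Longrightarrow> poly (G e) a \<noteq> 0"
  by (simp add: G_def poly_prod g_nz)

lemma v_G: "a \<in> R \<Longrightarrow> v (poly (G e) a) = (\<Sum>i\<le>r. int (e i) * v (poly (g i) a))"
  unfolding G_def poly_prod
  by (subst v_prod) (auto simp: v_power g_nz g_eval_K intro!: subsemiring_power[OF subsemiring_K])

lemma v_smult_G:
  "a \<in> R \<Longrightarrow> c \<in> K \<Longrightarrow> c \<noteq> 0 \<Longrightarrow>
    v (poly (smult c (G e)) a) = v c + (\<Sum>i\<le>r. int (e i) * v (poly (g i) a))"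
  by (simp add: v_mult G_eval_nz R_sub_K[OF G_eval_K] v_G)

lemma v_smult_G_pt:
  "cl < 2 * r \<Longrightarrow> c \<in> K \<Longrightarrow> c \<noteq> 0 \<Longrightarrow>
    v (poly (smult c (G e)) (pt cl)) = v c + (\<Sum>i\<le>r. int (e i) * int (expo r n i cl))"
  by (subst v_smult_G) (auto simp: pt_R v_pt)

text \<open>The \<open>g i\<close> are monic, so leading coefficients determine the constant. The
  exponents are read off from valuations: column \<open>0\<close> sees only \<open>g 0\<close>, and
  column \<open>r - 1 + i\<close> sees only \<open>g i\<close>.\<close>

lemma smult_G_inj:
  assumes eq: "smult c (G e) = smult d (G e')" and c: "c \<noteq> 0"
  shows "c = d" and "i \<le> r \<Longrightarrow> e i = e' i"
proof -
  have "lead_coeff (smult c (G e)) = lead_coeff (smult d (G e'))" using eq by simp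
  then show cd: "c = d" by (simp only: lead_coeff_smult G_monic mult_1_right)
  have "smult (1 / c) (smult c (G e)) = smult (1 / c) (smult c (G e'))" using eq cd by simp
  with c have "G e = G e'" by simp
  then have *: "(\<Sum>i\<le>r. int (e i) * int (expo r n i cl)) = (\<Sum>i\<le>r. int (e' i) * int (expo r n i cl))"
    if "cl < 2 * r" for cl
  proof -
    have "v (poly (G e) (pt cl)) = (\<Sum>i\<le>r. int (e i) * int (expo r n i cl))" for e
      using v_smult_G_pt[OF that, of 1 e] by (simp add: K_closed v_1)
    with \<open>G e = G e'\<close> show ?thesis by metis
  qed
  assume i: "i \<le> r"
  show "e i = e' i"
  proof (cases "i = 0")
    case True
    have "int n * int (e 0) = int n * int (e' 0)"
      using *[of 0] r sum_expo_other[of 0 r "\<lambda>i. int (e i)" n]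
        sum_expo_other[of 0 r "\<lambda>i. int (e' i)" n] by simp
    with True n show ?thesis by simp
  next
    case False
    with i r have "r - 1 + i < 2 * r" "1 \<le> i" by auto
    then have "int (n + 1) * int (e i) = int (n + 1) * int (e' i)"
      using *[of "r - 1 + i"] i sum_expo_single[of i r "\<lambda>i. int (e i)" n]
        sum_expo_single[of i r "\<lambda>i. int (e' i)" n] by simp
    then have "int (e i) = int (e' i)"
      by (metis mult_cancel_left of_nat_0_neq add_is_0 one_neq_zero of_nat_eq_0_iff)
    then show ?thesis by simp
  qed
qed

lemma divisors_G:
  assumes "x \<in> poly_ring K" "y \<in> poly_ring K" "c \<in> K" "c \<noteq> 0" "x * y = smult c (f ^ k)"
  shows "\<exists>d e. d \<in> K \<and> d \<noteq> 0 \<and> x = smult d (G e)"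
  using divisors[of x y c k] assms unfolding f_def G_def by blast

text \<open>By \<open>cover\<close>, the valuation at any point of \<open>R\<close> is bounded below
  by the value on one column, so integrality need only be tested on columns.\<close>

lemma smult_G_int_val:
  assumes c: "c \<in> K" "c \<noteq> 0"
    and ge: "\<And>cl. 0 \<le> v c + (\<Sum>i\<le>r. int (e i) * int (expo r n i cl))"
  shows "smult c (G e) \<in> IntR"
  unfolding int_val_iff
proof (intro conjI ballI)
  show "smult c (G e) \<in> poly_ring K"
    using poly_ring_smult[OF subsemiring_K c(1) poly_ring_R_sub_K[OF G_R]] .
next
  fix a assume a: "a \<in> R"
  obtain cl where cl: "\<forall>i\<le>r. int (expo r n i cl) \<le> v (poly (g i) a)"
    using cover[OF a] by blast
  have "0 \<le> v c + (\<Sum>i\<le>r. int (e i) * int (expo r n i cl))" by (rule ge)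
  also have "\<dots> \<le> v c + (\<Sum>i\<le>r. int (e i) * v (poly (g i) a))"
    using cl by (intro add_left_mono sum_mono mult_left_mono) auto
  also have "\<dots> = v (poly (smult c (G e)) a)" using v_smult_G[OF a c] by simp
  finally have "0 \<le> v (poly (smult c (G e)) a)" .
  then show "poly (smult c (G e)) a \<in> R"
    using c R_sub_K[OF G_eval_K[OF a, of e]] by (simp add: in_R_iff K_closed)
qed

text \<open>The divisors of powers of \<^term>\<open>F\<close> in \<^term>\<open>IntR\<close> are, up to units, parametrized by the
  lattice points \<open>(s, t)\<close> of a plane cone.\<close>

definition adm :: "int \<Rightarrow> int \<Rightarrow> bool" where
  "adm s t \<longleftrightarrow> (int n + 1) * M' * t \<le> s \<and> - ((int n + 1) * M * t) \<le> s"

definition shape :: "'a poly \<Rightarrow> int \<Rightarrow> int \<Rightarrow> bool" where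
  "shape x s t \<longleftrightarrow> adm s t \<and> (\<exists>c e. c \<in> K \<and> c \<noteq> 0 \<and> x = smult c (G e) \<and> v c = - (int n * s) \<and>
     int (e 0) = s \<and> (\<forall>i. 1 \<le> i \<longrightarrow> i \<le> r \<longrightarrow> int (e i) = s + t * al i))"

text \<open>The right side is integrality on the columns \<open>r - 1 + i\<close>. Only extreme
  entries of the kernel vector matter: the smallest, \<open>- M'\<close>, when \<open>t\<close> is
  nonnegative, and the largest, \<open>M\<close>, when \<open>t\<close> is negative.\<close>

lemma adm_iff: "adm s t \<longleftrightarrow> (\<forall>i. 1 \<le> i \<longrightarrow> i \<le> r \<longrightarrow> 0 \<le> s + (int n + 1) * (t * al i))"
proof
  assume a: "adm s t"
  show "\<forall>i. 1 \<le> i \<longrightarrow> i \<le> r \<longrightarrow> 0 \<le> s + (int n + 1) * (t * al i)"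
  proof (intro allI impI)
    fix i assume i: "1 \<le> i" "i \<le> r"
    show "0 \<le> s + (int n + 1) * (t * al i)"
    proof (cases "t \<ge> 0")
      case True
      then have "(int n + 1) * (t * (- M')) \<le> (int n + 1) * (t * al i)"
        using al_bounds[OF i] by (intro mult_left_mono) auto
      with a show ?thesis by (simp add: adm_def algebra_simps)
    next
      case False
      then have "(int n + 1) * (t * M) \<le> (int n + 1) * (t * al i)"
        using al_bounds[OF i] by (intro mult_left_mono mult_left_mono_neg) auto
      with a show ?thesis by (simp add: adm_def algebra_simps)
    qed
  qed
next
  assume "\<forall>i. 1 \<le> i \<longrightarrow> i \<le> r \<longrightarrow> 0 \<le> s + (int n + 1) * (t * al i)"
  then have "0 \<le> s + (int n + 1) * (t * al r)" "0 \<le> s + (int n + 1) * (t * al (r - 1))"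
    using r by auto
  then show "adm s t" unfolding adm_def al_top al_below by (simp add: algebra_simps)
qed

lemma adm_nonneg: "adm s t \<Longrightarrow> 0 \<le> s"
proof (cases "t \<ge> 0")
  case True
  assume "adm s t"
  moreover have "0 \<le> (int n + 1) * M' * t" using True M_ge by simp
  ultimately show ?thesis unfolding adm_def by linarith
next
  case False
  assume "adm s t"
  moreover have "(int n + 1) * M * t \<le> 0" using False M_ge by (intro mult_nonneg_nonpos) auto
  ultimately show ?thesis unfolding adm_def by linarith
qed

lemma adm_0:
  assumes "adm 0 t"
  shows "t = 0"
proof -
  have "0 < (int n + 1) * M'" "0 < (int n + 1) * M" using M_ge by auto
  moreover have "(int n + 1) * M' * t \<le> 0" "0 \<le> (int n + 1) * M * t"
    using assms by (auto simp: adm_def)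
  ultimately have "t \<le> 0" "0 \<le> t" by (metis mult_le_cancel_left_pos mult_zero_right)+
  then show ?thesis by simp
qed

text \<open>Used at \<open>- t\<close> to find a partner for a given shape, so that the product is a
  power of \<open>F\<close> up to a unit. The witness dominates both boundary slopes at
  once.\<close>

lemma adm_exists: "\<exists>s\<ge>0. adm s t"
proof -
  have "adm ((int n + 1) * (M + M') * \<bar>t\<bar>) t"
    unfolding adm_def
  proof
    have "(int n + 1) * M' * t \<le> (int n + 1) * (M + M') * t" if "t \<ge> 0"
      using that M_ge by (intro mult_right_mono mult_left_mono) auto
    moreover have "(int n + 1) * M' * t \<le> (int n + 1) * (M + M') * \<bar>t\<bar>" if "t \<le> 0"
    proof -
      have "(int n + 1) * M' * t \<le> 0" using that M_ge by (intro mult_nonneg_nonpos) auto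
      also have "0 \<le> (int n + 1) * (M + M') * \<bar>t\<bar>"
        using M_ge by (intro mult_nonneg_nonneg) auto
      finally show ?thesis .
    qed
    ultimately show "(int n + 1) * M' * t \<le> (int n + 1) * (M + M') * \<bar>t\<bar>"
      by (cases "t \<ge> 0") auto
    have "(int n + 1) * M * (- t) \<le> (int n + 1) * M * \<bar>t\<bar>"
      using M_ge by (intro mult_left_mono) auto
    also have "\<dots> \<le> (int n + 1) * (M + M') * \<bar>t\<bar>"
      using M_ge by (intro mult_right_mono mult_left_mono) auto
    finally have "(int n + 1) * M * (- t) \<le> (int n + 1) * (M + M') * \<bar>t\<bar>" .
    then show "- ((int n + 1) * M * t) \<le> (int n + 1) * (M + M') * \<bar>t\<bar>" by simp
  qed
  then show ?thesis using adm_nonneg by blast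
qed

lemma adm_add: "adm s t \<Longrightarrow> adm s' t' \<Longrightarrow> adm (s + s') (t + t')"
  by (auto simp: adm_def algebra_simps)

lemma shape_adm: "shape x s t \<Longrightarrow> adm s t"
  by (simp add: shape_def)

lemma shape_nonneg: "shape x s t \<Longrightarrow> 0 \<le> s"
  using shape_adm adm_nonneg by blast

text \<open>\<open>s\<close> is the exponent of \<open>g 0\<close>, and \<open>t\<close> is
  recovered from the exponent of \<open>g r\<close> because \<open>al r = M\<close> is
  nonzero.\<close>

lemma shape_unique:
  assumes "shape x s t" "shape x s' t'"
  shows "s = s' \<and> t = t'"
proof -
  obtain c e where 1: "c \<noteq> 0" "x = smult c (G e)" "int (e 0) = s"
    "\<forall>i. 1 \<le> i \<longrightarrow> i \<le> r \<longrightarrow> int (e i) = s + t * al i"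
    using assms(1) unfolding shape_def by blast
  obtain d e' where 2: "x = smult d (G e')" "int (e' 0) = s'"
    "\<forall>i. 1 \<le> i \<longrightarrow> i \<le> r \<longrightarrow> int (e' i) = s' + t' * al i"
    using assms(2) unfolding shape_def by blast
  have eq: "e i = e' i" if "i \<le> r" for i
    using smult_G_inj(2)[OF _ 1(1) that, of e d e'] 1(2) 2(1) by simp
  from eq[of 0] 1 2 have s: "s = s'" by simp
  moreover have "t * al r = t' * al r"
  proof -
    have "s + t * al r = s' + t' * al r"
      using eq[of r] 1(4)[rule_format, of r] 2(3)[rule_format, of r] r by auto
    with s show ?thesis by linarith
  qed
  ultimately show ?thesis using M_ge by (simp add: al_top)
qed

lemma shape_mult:
  assumes "shape x s t" "shape y s' t'"
  shows "shape (x * y) (s + s') (t + t')"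
proof -
  obtain c e where 1: "c \<in> K" "c \<noteq> 0" "x = smult c (G e)" "v c = - (int n * s)" "int (e 0) = s"
    "\<forall>i. 1 \<le> i \<longrightarrow> i \<le> r \<longrightarrow> int (e i) = s + t * al i"
    using assms(1) unfolding shape_def by blast
  obtain d e' where 2: "d \<in> K" "d \<noteq> 0" "y = smult d (G e')" "v d = - (int n * s')" "int (e' 0) = s'"
    "\<forall>i. 1 \<le> i \<longrightarrow> i \<le> r \<longrightarrow> int (e' i) = s' + t' * al i"
    using assms(2) unfolding shape_def by blast
  have "x * y = smult (c * d) (G (\<lambda>i. e i + e' i))"
    using 1 2 by (simp add: G_add mult.commute)
  moreover have "v (c * d) = - (int n * (s + s'))" using 1 2 by (simp add: v_mult algebra_simps)
  ultimately show ?thesis unfolding shape_def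
    using 1 2 assms shape_adm adm_add
    by (intro conjI exI[of _ "c * d"] exI[of _ "\<lambda>i. e i + e' i"]) (auto simp: K_closed algebra_simps)
qed

lemma shape_prod_list:
  assumes "\<And>x. x \<in> set xs \<Longrightarrow> shape x (\<sigma> x) (\<tau> x)"
  shows "shape (prod_list xs) (sum_list (map \<sigma> xs)) (sum_list (map \<tau> xs))"
  using assms
proof (induction xs)
  case Nil
  show ?case unfolding shape_def
    by (intro conjI exI[of _ 1] exI[of _ "\<lambda>_. 0"]) (auto simp: adm_def G_0 K_closed v_1)
qed (auto intro: shape_mult)

lemma shape_F: "shape F 1 0"
  unfolding shape_def F_def f_eq_G
  by (intro conjI exI[of _ "1 / p ^ n"] exI[of _ "\<lambda>_. 1"])
    (auto simp: adm_def p_nz v_inverse v_power v_p p_K K_divide K_closed subsemiring_power[OF subsemiring_K])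

lemma shape_F_power: "shape (F ^ k) (int k) 0"
proof (induction k)
  case 0
  show ?case unfolding shape_def
    by (intro conjI exI[of _ 1] exI[of _ "\<lambda>_. 0"]) (auto simp: adm_def G_0 K_closed v_1)
next
  case (Suc k)
  from shape_mult[OF shape_F this] show ?case by (simp add: add.commute)
qed

lemma shape_smult:
  assumes "shape x s t" "u \<in> K" "u \<noteq> 0" "v u = 0"
  shows "shape (smult u x) s t"
proof -
  obtain c e where 1: "c \<in> K" "c \<noteq> 0" "x = smult c (G e)" "v c = - (int n * s)" "int (e 0) = s"
    "\<forall>i. 1 \<le> i \<longrightarrow> i \<le> r \<longrightarrow> int (e i) = s + t * al i"
    using assms(1) unfolding shape_def by blast
  then show ?thesis unfolding shape_def using assms shape_adm
    by (intro conjI exI[of _ "u * c"] exI[of _ e]) (auto simp: K_closed v_mult)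
qed

text \<open>Because of the factor \<open>n + 1\<close>, the cone condition is stronger than
  nonnegativity of the exponents \<open>s + t * al i\<close>, so the conversions by
  \<open>nat\<close> lose nothing.\<close>

lemma shape_exists:
  assumes "adm s t"
  shows "\<exists>x. shape x s t"
proof -
  have nn: "0 \<le> s + t * al i" if "1 \<le> i" "i \<le> r" for i
  proof (cases "t * al i \<ge> 0")
    case True
    then show ?thesis using adm_nonneg[OF assms] by simp
  next
    case False
    then have "(int n + 1) * (t * al i) \<le> 1 * (t * al i)" by (intro mult_right_mono_neg) auto
    then show ?thesis using assms that adm_iff by fastforce
  qed
  define e where "e i = (if i = 0 then nat s else nat (s + t * al i))" for i
  show ?thesis unfolding shape_def
    by (intro exI[of _ "smult (1 / p ^ (n * nat s)) (G e)"] conjI assms exI[of _ "1 / p ^ (n * nat s)"] exI[of _ e])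
      (use nn adm_nonneg[OF assms] in \<open>auto simp: e_def p_nz v_inverse v_power v_p p_K K_divide K_closed subsemiring_power[OF subsemiring_K]\<close>)
qed

text \<open>On the columns of sum \<open>n\<close> the recurrence cancels the contribution of
  \<open>t\<close>, and \<open>v c\<close> cancels the rest, so the valuation there is exactly
  \<open>0\<close>. On the remaining columns integrality is the cone condition.\<close>

lemma shape_int_val:
  assumes "shape x s t"
  shows "x \<in> IntR"
proof -
  obtain c e where 1: "c \<in> K" "c \<noteq> 0" "x = smult c (G e)" "v c = - (int n * s)" "int (e 0) = s"
    "\<forall>i. 1 \<le> i \<longrightarrow> i \<le> r \<longrightarrow> int (e i) = s + t * al i"
    using assms(1) unfolding shape_def by blast
  have r1: "r \<ge> 1" using r by simp
  show ?thesis unfolding 1(3)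
  proof (rule smult_G_int_val[OF 1(1,2)])
    fix cl
    show "0 \<le> v c + (\<Sum>i\<le>r. int (e i) * int (expo r n i cl))"
    proof (rule expo_class_cases[OF r1, of cl])
      assume "cl = 0 \<or> 2 * r \<le> cl"
      from sum_expo_other[OF this r1, of "\<lambda>i. int (e i)" n] show ?thesis using 1 by simp
    next
      assume cl: "1 \<le> cl" "cl < r"
      have "(\<Sum>i\<le>r. int (e i) * int (expo r n i cl)) = (int n - 1) * int (e cl) + int (e (cl + 1))"
        using sum_expo_chain[OF cl, of "\<lambda>i. int (e i)" n] n by (simp add: of_nat_diff)
      also have "\<dots> = (int n - 1) * (s + t * al cl) + (s + t * al (cl + 1))"
        using 1(6) cl by simp
      also have "\<dots> = int n * s" unfolding alt_Suc[OF cl] by (simp add: algebra_simps)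
      finally show ?thesis using 1 by simp
    next
      fix j assume j: "1 \<le> j" "j \<le> r" "cl = r - 1 + j"
      have "(\<Sum>i\<le>r. int (e i) * int (expo r n i cl)) = (int n + 1) * (s + t * al j)"
        using sum_expo_single[OF j(1,2), of "\<lambda>i. int (e i)" n] j 1(6) by simp
      moreover have "0 \<le> s + (int n + 1) * (t * al j)"
        using shape_adm[OF assms] j by (simp add: adm_iff)
      ultimately show ?thesis using 1 by (simp add: algebra_simps)
    qed
  qed
qed

text \<open>Both cofactors have nonnegative valuations that add up to \<open>0\<close> at
  \<open>pt cl\<close> for \<open>cl < r\<close>, so each vanishes. Column \<open>0\<close> then
  fixes \<open>v c\<close>, the chain columns give the recurrence for the exponents, and the other
  points give the cone condition.\<close>

lemma divisor_shape:
  assumes x: "x \<in> IntR" and y: "y \<in> IntR" and xy: "x * y = F ^ k"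
  shows "\<exists>s t. shape x s t"
proof -
  have eqf: "F ^ k = smult ((1 / p ^ n) ^ k) (f ^ k)" by (simp add: F_def smult_power)
  have q: "(1 / p ^ n) ^ k \<in> K" "(1 / p ^ n) ^ k \<noteq> 0"
    using p_K p_nz by (auto intro!: K_divide K_closed subsemiring_power[OF subsemiring_K])
  have xy': "x * y = smult ((1 / p ^ n) ^ k) (f ^ k)" "y * x = smult ((1 / p ^ n) ^ k) (f ^ k)"
    using xy eqf by (auto simp: mult.commute)
  have xK: "x \<in> poly_ring K" "y \<in> poly_ring K" using x y by (auto simp: int_val_iff)
  obtain c e where c: "c \<in> K" "c \<noteq> 0" "x = smult c (G e)"
    using divisors_G[OF xK q xy'(1)] by blast
  obtain d e' where d: "d \<in> K" "d \<noteq> 0" "y = smult d (G e')"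
    using divisors_G[OF xK(2,1) q xy'(2)] by blast
  have ge: "0 \<le> v (poly x a)" "0 \<le> v (poly y a)" if "a \<in> R" for a
  proof -
    have "poly x a \<noteq> 0" "poly y a \<noteq> 0" using c d that by (auto simp: G_eval_nz)
    then show "0 \<le> v (poly x a)" "0 \<le> v (poly y a)"
      using x y that by (auto simp: int_val_iff in_R_iff)
  qed
  \<comment> \<open>These columns have sum \<open>n\<close>, which the denominator
    \<open>p ^ n\<close> cancels exactly.\<close>
  have "v (poly (F ^ k) (pt cl)) = 0" if "cl < r" for cl
  proof -
    have cl2: "cl < 2 * r" using that by simp
    have "(\<Sum>i\<le>r. int 1 * int (expo r n i cl)) = int n"
    proof (cases "cl = 0")
      case True
      with r show ?thesis using sum_expo_other[of cl r "\<lambda>_. 1 :: int" n] by simp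
    next
      case False
      with that n show ?thesis using sum_expo_chain[of cl r "\<lambda>_. 1 :: int" n] by simp
    qed
    then have "v (poly F (pt cl)) = 0"
      using v_smult_G_pt[OF cl2, of "1 / p ^ n" "\<lambda>_. 1"] p_K p_nz
      by (simp add: F_def f_eq_G v_inverse v_power v_p K_divide K_closed subsemiring_power[OF subsemiring_K])
    moreover have "poly F (pt cl) \<noteq> 0" "poly F (pt cl) \<in> K"
      using p_nz p_K G_eval_nz[OF pt_R[OF cl2]] R_sub_K[OF G_eval_K[OF pt_R[OF cl2]]]
      by (auto simp: F_def f_eq_G intro!: K_divide K_closed subsemiring_power[OF subsemiring_K])
    ultimately show ?thesis by (simp add: poly_power v_power)
  qed
  moreover have "v (poly (F ^ k) (pt cl)) = v (poly x (pt cl)) + v (poly y (pt cl))" if "cl < r" for cl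
  proof -
    have "pt cl \<in> R" using that pt_R by simp
    then have "poly x (pt cl) \<noteq> 0" "poly y (pt cl) \<noteq> 0" "poly x (pt cl) \<in> K" "poly y (pt cl) \<in> K"
      using c d x y by (auto simp: G_eval_nz int_val_iff R_sub_K)
    then show ?thesis unfolding xy[symmetric] by (simp add: v_mult)
  qed
  ultimately have "v (poly x (pt cl)) = 0" if "cl < r" for cl
    using ge[of "pt cl"] pt_R[of cl] that by fastforce
  then have eq: "v c + (\<Sum>i\<le>r. int (e i) * int (expo r n i cl)) = 0" if "cl < r" for cl
    using v_smult_G_pt[of cl c e] c that by simp
  define s where "s = int (e 0)"
  \<comment> \<open>The constant exponent vector \<open>s\<close> already balances
    \<open>v c\<close> on the chain columns; subtracting it leaves a solution of the homogeneous
    recurrence.\<close>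
  define w where "w i = int (e i) - s" for i
  have vc: "v c = - (int n * s)"
    using eq[of 0] r sum_expo_other[of 0 r "\<lambda>i. int (e i)" n] by (simp add: s_def)
  have rec: "of_nat (n - 1) * w j + w (j + 1) = 0" if "1 \<le> j" "j < r" for j
    using eq[OF that(2)] sum_expo_chain[OF that, of "\<lambda>i. int (e i)" n] vc n
    by (simp add: w_def of_nat_diff algebra_simps)
  define t where "t = al 1 * w 1"
  have e: "int (e i) = s + t * al i" if "1 \<le> i" "i \<le> r" for i
    using alt_recurrence_unique[of r n w i] rec n that by (simp add: t_def w_def)
  have "adm s t" unfolding adm_iff
  proof (intro allI impI)
    fix j assume j: "1 \<le> j" "j \<le> r"
    then have cl: "r - 1 + j < 2 * r" by simp
    have "0 \<le> v (poly x (pt (r - 1 + j)))" using ge(1) pt_R[OF cl] .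
    also have "\<dots> = - (int n * s) + (int n + 1) * (s + t * al j)"
      using v_smult_G_pt[OF cl c(1,2), of e] c(3) vc e[OF j]
        sum_expo_single[OF j, of "\<lambda>i. int (e i)" n] by simp
    finally show "0 \<le> s + (int n + 1) * (t * al j)" by (simp add: algebra_simps)
  qed
  then show ?thesis unfolding shape_def using c vc e s_def by blast
qed

lemma shape_zero:
  assumes "shape x (int k) 0"
  obtains u where "u \<in> K" "u \<noteq> 0" "v u = 0" "x = smult u (F ^ k)"
proof -
  obtain c e where 1: "c \<in> K" "c \<noteq> 0" "x = smult c (G e)" "v c = - (int n * int k)" "int (e 0) = int k"
    "\<forall>i. 1 \<le> i \<longrightarrow> i \<le> r \<longrightarrow> int (e i) = int k + 0 * al i"
    using assms(1) unfolding shape_def by blast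
  have "e i = k * 1" if "i \<le> r" for i
    using 1(5,6) that by (cases "i = 0") auto
  then have "G e = G (\<lambda>i. k * 1)" by (intro G_cong) auto
  then have Ge: "G e = f ^ k" by (simp only: f_eq_G G_power)
  let ?q = "(p ^ n) ^ k"
  have q: "?q \<in> K" "?q \<noteq> 0" using p_K p_nz
    by (auto intro!: subsemiring_power[OF subsemiring_K])
  have "F ^ k = smult (1 / ?q) (f ^ k)" by (simp add: F_def smult_power power_one_over)
  then have "x = smult (c * ?q) (F ^ k)" using 1(3) Ge q by simp
  moreover have "v ?q = int n * int k"
    using p_K p_nz by (simp add: v_power v_p subsemiring_power[OF subsemiring_K])
  then have "v (c * ?q) = 0" using v_mult[OF 1(1) q(1) 1(2) q(2)] 1(4) by simp
  ultimately show thesis using 1 q that[of "c * ?q"] by (auto simp: K_closed)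
qed

lemma F_power_int_val: "F ^ k \<in> IntR"
  using shape_int_val[OF shape_F_power] .

lemma F_int_val: "F \<in> IntR"
  using shape_int_val[OF shape_F] .

section \<open>Units, factors and irreducibles in terms of lattice points\<close>

lemma shape_nz:
  assumes "shape x s t"
  shows "x \<noteq> 0"
proof -
  obtain c e where "c \<noteq> 0" "x = smult c (G e)" using assms unfolding shape_def by blast
  then show ?thesis using G_nz by simp
qed

text \<open>\<open>s\<close> is additive and nonnegative, so it vanishes on units. Conversely the
  cone is pointed: \<open>s = 0\<close> forces \<open>t = 0\<close>, which leaves a constant of
  valuation \<open>0\<close>.\<close>

lemma shape_unit_in:
  assumes "shape x s t"
  shows "unit_in IntR x \<longleftrightarrow> s = 0"
proof
  assume "s = 0"
  with assms adm_0[of t] shape_adm have "shape x (int 0) 0" by auto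
  then obtain u where u: "u \<in> K" "u \<noteq> 0" "v u = 0" "x = smult u (F ^ 0)"
    by (rule shape_zero)
  then have "1 / u \<in> R" by (simp add: in_R_iff v_inverse K_divide K_closed)
  then have "[:1 / u:] \<in> IntR" by (rule int_val_const)
  moreover have "x * [:1 / u:] = 1" using u by (simp add: one_pCons)
  ultimately show "unit_in IntR x" unfolding unit_in_def using shape_int_val[OF assms] by blast
next
  assume "unit_in IntR x"
  \<comment> \<open>A unit and its inverse are cofactors of \<open>F ^ 0\<close>, so
    \<open>divisor_shape\<close> applies to the inverse.\<close>
  then obtain y where y: "y \<in> IntR" "x * y = F ^ 0" by (auto simp: unit_in_def)
  obtain s' t' where y': "shape y s' t'"
    using divisor_shape[of y x 0] y shape_int_val[OF assms] by (auto simp: mult.commute)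
  have "shape (F ^ 0) (s + s') (t + t')"
    using shape_mult[OF assms y'] y(2) by simp
  then have "s + s' = 0" using shape_unique[OF _ shape_F_power[of 0]] by simp
  with shape_nonneg[OF assms] shape_nonneg[OF y'] show "s = 0" by simp
qed

lemma shape_cofactor:
  assumes "shape x s t"
  obtains y k where "y \<in> IntR" "x * y = F ^ k"
proof -
  obtain s' where s': "s' \<ge> 0" "adm s' (- t)" using adm_exists by blast
  then obtain y where y: "shape y s' (- t)" using shape_exists by blast
  have "shape (x * y) (int (nat (s + s'))) 0"
    using shape_mult[OF assms y] shape_nonneg[OF assms] s'(1) by simp
  then obtain u where u: "u \<in> K" "u \<noteq> 0" "v u = 0" "x * y = smult u (F ^ nat (s + s'))"
    by (rule shape_zero)
  then have "x * smult (1 / u) y = F ^ nat (s + s')" by simp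
  moreover have "smult (1 / u) y \<in> IntR"
    using shape_int_val[OF y] u
    by (intro int_val_smult) (auto simp: in_R_iff v_inverse K_divide K_closed)
  ultimately show thesis using that by blast
qed

text \<open>A partner with opposite \<open>t\<close> completes the product to a power of
  \<open>F\<close>; each factor then divides that power and \<open>divisor_shape\<close> applies.
  Uniqueness of the coordinates makes them additive.\<close>

lemma shape_factors:
  assumes "shape (a * b) s t" "a \<in> IntR" "b \<in> IntR"
  obtains s1 t1 s2 t2 where "shape a s1 t1" "shape b s2 t2" "s = s1 + s2" "t = t1 + t2"
proof -
  obtain y k where y: "y \<in> IntR" "a * b * y = F ^ k" using shape_cofactor[OF assms(1)] .
  have "a * (b * y) = F ^ k" "b * (a * y) = F ^ k" using y(2) by (simp_all add: mult_ac)
  then obtain s1 t1 s2 t2 where st: "shape a s1 t1" "shape b s2 t2"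
    using divisor_shape assms(2,3) y(1) int_val_closed(4) by meson
  from shape_unique[OF assms(1) shape_mult[OF this]] st that show thesis by blast
qed

text \<open>Reduces irreducibility to an additive question: it suffices that the lattice point
  \<open>(s, t)\<close> has no decomposition in the cone into two points with positive first
  coordinate.\<close>

lemma irred_shape:
  assumes x: "shape x s t" and s: "s > 0"
    and split: "\<And>s1 t1 s2 t2. adm s1 t1 \<Longrightarrow> adm s2 t2 \<Longrightarrow> s1 + s2 = s \<Longrightarrow> t1 + t2 = t \<Longrightarrow>
      s1 = 0 \<or> s2 = 0"
  shows "irred_in IntR x"
  unfolding irred_in_def
proof (intro conjI ballI impI)
  show "x \<in> IntR" "x \<noteq> 0" "\<not> unit_in IntR x"
    using shape_int_val[OF x] shape_nz[OF x] shape_unit_in[OF x] s by auto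
  fix a b assume ab: "a \<in> IntR" "b \<in> IntR" "x = a * b"
  with x obtain s1 t1 s2 t2 where st: "shape a s1 t1" "shape b s2 t2" "s = s1 + s2" "t = t1 + t2"
    using shape_factors by metis
  then have "s1 = 0 \<or> s2 = 0" using split[of s1 t1 s2 t2] shape_adm by simp
  then show "unit_in IntR a \<or> unit_in IntR b" using shape_unit_in st by blast
qed

lemma irred_F: "irred_in IntR F"
proof (rule irred_shape[OF shape_F])
  fix s1 t1 s2 t2 assume "adm s1 t1" "adm s2 t2" "s1 + s2 = 1"
  then show "s1 = 0 \<or> s2 = 0" using adm_nonneg[of s1 t1] adm_nonneg[of s2 t2] by linarith
qed simp

section \<open>The exponent at which unique factorization fails\<close>

definition S where "S = (n + 1) * ((n - 1) ^ (r - 1) + (n - 1) ^ (r - 2))"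

lemma S_eq: "int S = (int n + 1) * M' + (int n + 1) * M"
  using n by (simp add: S_def M_def M'_def of_nat_diff algebra_simps)

text \<open>Besides positivity, this gives \<open>S > 2\<close>, which separates a factorization of
  \<open>F ^ S\<close> into two factors from the one into \<open>S\<close> copies of
  \<open>F\<close>.\<close>

lemma S_ge: "S \<ge> 6"
proof -
  have "3 * 1 \<le> (int n + 1) * M" "3 * 1 \<le> (int n + 1) * M'"
    using M_ge n by (intro mult_mono; simp)+
  then show ?thesis using S_eq by linarith
qed

text \<open>If \<open>t1 + t2 = 1\<close>, one summand has \<open>t\<close> at least
  \<open>1\<close>. The boundary inequality then makes it use up all of \<open>s\<close>, so the
  other has first coordinate \<open>0\<close>.\<close>

lemma irred_extremal_pos:
  assumes x: "shape x ((int n + 1) * M') 1"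
  shows "irred_in IntR x"
proof (rule irred_shape[OF x])
  show "0 < (int n + 1) * M'" using M_ge by simp
  fix s1 t1 s2 t2
  assume a: "adm s1 t1" "adm s2 t2" "s1 + s2 = (int n + 1) * M'" "t1 + t2 = 1"
  have *: "s2 = 0" if "adm s1 t1" "adm s2 t2" "s1 + s2 = (int n + 1) * M'" "t1 \<ge> 1" for s1 s2 t1 t2
  proof -
    have "(int n + 1) * M' * 1 \<le> (int n + 1) * M' * t1"
      using that M_ge by (intro mult_left_mono) auto
    also have "\<dots> \<le> s1" using that by (simp add: adm_def)
    finally show ?thesis using that adm_nonneg[of s2 t2] by simp
  qed
  show "s1 = 0 \<or> s2 = 0"
    using *[of s1 t1 s2 t2] *[of s2 t2 s1 t1] a by linarith
qed

text \<open>The mirror image on the other boundary ray: one summand has \<open>t\<close> at most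
  \<open>- 1\<close> and uses up all of \<open>s\<close>.\<close>

lemma irred_extremal_neg:
  assumes x: "shape x ((int n + 1) * M) (- 1)"
  shows "irred_in IntR x"
proof (rule irred_shape[OF x])
  show "0 < (int n + 1) * M" using M_ge by simp
  fix s1 t1 s2 t2
  assume a: "adm s1 t1" "adm s2 t2" "s1 + s2 = (int n + 1) * M" "t1 + t2 = - 1"
  have *: "s2 = 0" if "adm s1 t1" "adm s2 t2" "s1 + s2 = (int n + 1) * M" "t1 \<le> - 1" for s1 s2 t1 t2
  proof -
    have "(int n + 1) * M * 1 \<le> (int n + 1) * M * (- t1)"
      using that M_ge by (intro mult_left_mono) auto
    also have "\<dots> \<le> s1" using that by (simp add: adm_def)
    finally show ?thesis using that adm_nonneg[of s2 t2] by simp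
  qed
  show "s1 = 0 \<or> s2 = 0"
    using *[of s1 t1 s2 t2] *[of s2 t2 s1 t1] a by linarith
qed

text \<open>The extremal points at \<open>t = 1\<close> and \<open>t = - 1\<close> add up to
  \<open>(S, 0)\<close>. Up to a unit, moved into the first factor, their product is
  \<open>F ^ S\<close>: two irreducible factors against \<open>S\<close> copies of
  \<open>F\<close>.\<close>

lemma not_unique_S: "\<not> factors_uniquely_in IntR (F ^ S)"
proof
  assume unique: "factors_uniquely_in IntR (F ^ S)"
  have "adm ((int n + 1) * M') 1" "adm ((int n + 1) * M) (- 1)"
  proof -
    have "0 \<le> (int n + 1) * M'" "0 \<le> (int n + 1) * M"
      using M_ge by (intro mult_nonneg_nonneg; simp)+
    then show "adm ((int n + 1) * M') 1" "adm ((int n + 1) * M) (- 1)"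
      unfolding adm_def by linarith+
  qed
  then obtain a b where ab: "shape a ((int n + 1) * M') 1" "shape b ((int n + 1) * M) (- 1)"
    using shape_exists by meson
  have "shape (a * b) (int S) 0" using shape_mult[OF ab] S_eq by simp
  then obtain u where u: "u \<in> K" "u \<noteq> 0" "v u = 0" "a * b = smult u (F ^ S)"
    by (rule shape_zero)
  have "shape (smult (1 / u) a) ((int n + 1) * M') 1"
    using u by (intro shape_smult ab) (auto simp: v_inverse K_divide K_closed)
  then have "is_factorization_in IntR (F ^ S) [smult (1 / u) a, b]"
    unfolding is_factorization_in_def
    using irred_extremal_pos irred_extremal_neg[OF ab(2)] u by simp
  moreover have "is_factorization_in IntR (F ^ S) (replicate S F)"
    using irred_F by (simp add: is_factorization_in_def)
  ultimately have "length [smult (1 / u) a, b] = length (replicate S F)"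
    using unique unfolding factors_uniquely_in_def by blast
  with S_ge show False by simp
qed

section \<open>Unique factorization of the smaller powers\<close>

lemma factor_shapes:
  assumes fs: "is_factorization_in IntR (F ^ k) fs"
  obtains \<sigma> \<tau> where "\<And>x. x \<in> set fs \<Longrightarrow> shape x (\<sigma> x) (\<tau> x)"
    "sum_list (map \<sigma> fs) = int k" "sum_list (map \<tau> fs) = 0"
proof -
  have "\<exists>s t. shape x s t" if x: "x \<in> set fs" for x
  proof -
    obtain ys zs where ys: "fs = ys @ x # zs" using split_list[OF x] by blast
    have "x * (prod_list ys * prod_list zs) = F ^ k"
      using fs ys by (simp add: is_factorization_in_def mult_ac)
    moreover have "set fs \<subseteq> IntR" using fs
      by (auto simp: is_factorization_in_def irred_in_def)
    ultimately show ?thesis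
      using ys by (intro divisor_shape[of x "prod_list ys * prod_list zs"] int_val_closed
          subsemiring_prod_list[OF subsemiring_int_val]) auto
  qed
  then obtain \<sigma> \<tau> where st: "\<And>x. x \<in> set fs \<Longrightarrow> shape x (\<sigma> x) (\<tau> x)" by metis
  have "shape (F ^ k) (sum_list (map \<sigma> fs)) (sum_list (map \<tau> fs))"
    using shape_prod_list[of fs \<sigma> \<tau>] st fs by (simp add: is_factorization_in_def)
  from shape_unique[OF this shape_F_power] st show thesis using that by blast
qed

text \<open>If some factor has \<open>t \<noteq> 0\<close>, then positive and negative values of \<open>t\<close> both occur,
  and each unit of \<open>t\<close> of either sign costs its share of \<^term>\<open>S\<close> in \<open>s\<close>.\<close>

lemma small_power_tau_zero:
  assumes k: "k < S" and adm: "\<And>x. x \<in> set fs \<Longrightarrow> adm (\<sigma> x) (\<tau> x)"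
    and sum: "sum_list (map \<sigma> fs) = int k" "sum_list (map \<tau> fs) = 0" and x: "x \<in> set fs"
  shows "\<tau> x = 0"
proof (rule ccontr)
  assume nz: "\<tau> x \<noteq> 0"
  \<comment> \<open>The total positive and the total negative part of \<open>t\<close>; they agree
    because the coordinates \<open>t\<close> sum to \<open>0\<close>.\<close>
  define P N where "P = sum_list (map (\<lambda>x. max (\<tau> x) 0) fs)"
    and "N = sum_list (map (\<lambda>x. max (- \<tau> x) 0) fs)"
  have "P - N = sum_list (map \<tau> fs)"
    unfolding P_def N_def sum_list_subtractf[symmetric]
    by (intro arg_cong[of _ _ sum_list] map_cong) auto
  then have PN: "P = N" using sum by simp
  have "1 \<le> P \<or> 1 \<le> N"
    using nz sum_list_pos_ge_one[OF x, of \<tau>] sum_list_pos_ge_one[OF x, of "\<lambda>x. - \<tau> x"]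
    unfolding P_def N_def by linarith
  with PN have P1: "1 \<le> P" by simp
  have "int S * 1 \<le> int S * P" using P1 by (intro mult_left_mono) auto
  also have "int S * P = (int n + 1) * M' * P + (int n + 1) * M * N"
    using PN S_eq by (simp add: algebra_simps)
  also have "\<dots> = sum_list (map (\<lambda>x. (int n + 1) * M' * max (\<tau> x) 0 + (int n + 1) * M * max (- \<tau> x) 0) fs)"
    by (simp add: P_def N_def sum_list_addf sum_list_const_mult)
  also have "\<dots> \<le> sum_list (map \<sigma> fs)"
  proof (rule sum_list_mono)
    fix y assume "y \<in> set fs"
    from adm[OF this] show "(int n + 1) * M' * max (\<tau> y) 0 + (int n + 1) * M * max (- \<tau> y) 0 \<le> \<sigma> y"
      by (cases "\<tau> y \<ge> 0") (simp_all add: adm_def max_def)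
  qed
  finally show False using sum k by simp
qed

text \<open>Once every factor has \<open>t = 0\<close>, it is a unit times a power of
  \<open>F\<close>. Irreducibility makes that power the first, so the coordinates \<open>s\<close>,
  which sum to \<open>k\<close>, count the factors.\<close>

lemma factorization_small:
  assumes k: "k < S" and fs: "is_factorization_in IntR (F ^ k) fs"
  shows "length fs = k" and "x \<in> set fs \<Longrightarrow> assoc_in IntR F x"
proof -
  obtain \<sigma> \<tau> where st: "\<And>x. x \<in> set fs \<Longrightarrow> shape x (\<sigma> x) (\<tau> x)"
    and sum: "sum_list (map \<sigma> fs) = int k" "sum_list (map \<tau> fs) = 0"
    using factor_shapes[OF fs] by blast
  have *: "\<sigma> x = 1 \<and> assoc_in IntR F x" if x: "x \<in> set fs" for x
  proof -
    have "\<tau> x = 0" using small_power_tau_zero[OF k _ sum x] st shape_adm by blast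
    then have "shape x (int (nat (\<sigma> x))) 0"
      using st[OF x] shape_nonneg[OF st[OF x]] by simp
    then obtain u where u: "u \<in> K" "u \<noteq> 0" "v u = 0" "x = smult u (F ^ nat (\<sigma> x))"
      by (rule shape_zero)
    have irr: "irred_in IntR x" using fs x by (simp add: is_factorization_in_def)
    then have "\<not> unit_in IntR x" by (simp add: irred_in_def)
    then have "\<sigma> x \<noteq> 0" using shape_unit_in[OF st[OF x]] by simp
    then have pos: "\<sigma> x \<ge> 1" using shape_nonneg[OF st[OF x]] by simp
    have "\<sigma> x = 1"
    proof (rule ccontr)
      assume "\<sigma> x \<noteq> 1"
      \<comment> \<open>An exponent of at least \<open>2\<close> would let one copy of
        \<open>F\<close> split off and leave the nonunit \<open>F ^ Suc ?m\<close>.\<close>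
      with pos have m: "nat (\<sigma> x) = Suc (Suc (nat (\<sigma> x) - 2))" by arith
      let ?m = "nat (\<sigma> x) - 2"
      have "x = smult u F * F ^ Suc ?m" using u(4) by (subst (asm) m) simp
      moreover have 1: "shape (smult u F) 1 0" using shape_smult[OF shape_F u(1-3)] .
      ultimately have "unit_in IntR (smult u F) \<or> unit_in IntR (F ^ Suc ?m)"
        using irr shape_int_val[OF 1] F_power_int_val unfolding irred_in_def by blast
      then show False using shape_unit_in[OF 1] shape_unit_in[OF shape_F_power[of "Suc ?m"]] by simp
    qed
    with u have "x = smult u F" by simp
    with \<open>\<sigma> x = 1\<close> show ?thesis using assoc_smult_unit[OF u(1-3) F_int_val]
      by simp
  qed
  have "sum_list (map \<sigma> fs) = sum_list (map (\<lambda>_. 1) fs)"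
    using * by (intro arg_cong[of _ _ sum_list] map_cong) auto
  then have "int (length fs) = int k" using sum(1) by (simp add: sum_list_triv)
  then show "length fs = k" by simp
  show "x \<in> set fs \<Longrightarrow> assoc_in IntR F x" using * by blast
qed

lemma unique_small: "k < S \<Longrightarrow> factors_uniquely_in IntR (F ^ k)"
  unfolding factors_uniquely_in_def
proof (intro allI impI conjI)
  fix fs gs
  assume k: "k < S"
    and "is_factorization_in IntR (F ^ k) fs \<and> is_factorization_in IntR (F ^ k) gs"
  then have fs: "is_factorization_in IntR (F ^ k) fs" and gs: "is_factorization_in IntR (F ^ k) gs"
    by auto
  note fs = factorization_small[OF k fs] and gs = factorization_small[OF k gs]
  show "length fs = length gs" using fs gs by simp
  show "\<exists>\<sigma>. bij_betw \<sigma> {..<length fs} {..<length fs} \<and>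
      (\<forall>i<length fs. assoc_in IntR (fs ! i) (gs ! \<sigma> i))"
  \<comment> \<open>All factors on both sides are associated to \<open>F\<close>, so any matching
    works and the identity is chosen.\<close>
  proof (intro exI[of _ id] conjI allI impI)
    fix i assume "i < length fs"
    then have "assoc_in IntR F (fs ! i)" "assoc_in IntR F (gs ! id i)"
      using fs gs by auto
    then show "assoc_in IntR (fs ! i) (gs ! id i)"
      using assoc_in_trans[OF subsemiring_int_val assoc_in_sym] by blast
  qed simp
qed

lemma least_S: "(LEAST k. k \<ge> 1 \<and> \<not> factors_uniquely_in IntR (F ^ k)) = S"
  using not_unique_S S_ge unique_small
  by (intro Least_equality) (auto simp: not_less[symmetric])

lemma not_abs_irred_F: "\<not> abs_irred_in IntR F"
  using not_unique_S by (auto simp: abs_irred_in_def)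

section \<open>Irreducible divisors and fixed divisor kernel\<close>


abbreviation PR where "PR \<equiv> poly_ring R"

lemmas PR_closed = subsemiringD[OF subsemiring_poly_ring[OF subsemiring_R]]

lemma g_eq_G: "i \<le> r \<Longrightarrow> g i = G (\<lambda>j. if j = i then 1 else 0)"
  unfolding G_def by (subst prod.remove[of _ i]) (auto intro!: prod.neutral)

lemma f_split: "i \<le> r \<Longrightarrow> f = g i * G (\<lambda>j. if j = i then 0 else 1)"
  unfolding f_eq_G by (subst g_eq_G, assumption, subst G_add[symmetric]) (auto intro!: G_cong)

lemma f_PR: "f \<in> PR"
  by (simp add: f_eq_G G_R)

lemma f_degree: "degree f > 0"
proof -
  have "degree f = degree (g 0) + degree (G (\<lambda>j. if j = 0 then 0 else 1))"
    using f_split[of 0] degree_mult_eq[of "g 0" "G (\<lambda>j. if j = 0 then 0 else 1)"] g_monic[of 0] G_nz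
    by force
  with g_degree[of 0] show ?thesis by simp
qed

lemma f_primitive: "primitive_poly R p f"
  unfolding primitive_poly_def
proof
  assume "\<forall>i. coeff f i \<in> principal_ideal R p"
  then have "lead_coeff f \<in> principal_ideal R p" by blast
  then obtain x where x: "x \<in> R" "1 = p * x"
    unfolding f_eq_G G_monic by (auto simp: principal_ideal_def)
  then have "x \<noteq> 0" by auto
  then have "v (p * x) = 1 + v x" "0 \<le> v x"
    using v_mult[OF p_K R_sub_K[OF x(1)] p_nz] v_p x(1) in_R_iff[of x] by simp_all
  moreover have "v (p * x) = 0" using x(2) v_1 by metis
  ultimately show False by simp
qed

lemma smult_PR: "c \<in> R \<Longrightarrow> h \<in> PR \<Longrightarrow> smult c h \<in> PR"
  using poly_ring_smult[OF subsemiring_R] .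

lemma unit_R:
  assumes "c \<in> K" "c \<noteq> 0" "v c = 0"
  shows "c \<in> R" "1 / c \<in> R"
  using assms by (auto simp: in_R_iff v_inverse K_divide K_closed)

lemma const_unit_in_PR:
  assumes "c \<in> K" "c \<noteq> 0" "v c = 0"
  shows "unit_in PR [:c:]"
proof -
  have "[:c:] = smult c 1" "[:1 / c:] = smult (1 / c) 1" by simp_all
  then have "[:c:] \<in> PR" "[:1 / c:] \<in> PR"
    using smult_PR[OF _ PR_closed(2)] unit_R[OF assms] by metis+
  moreover have "[:c:] * [:1 / c:] = 1" using assms by (simp add: one_pCons)
  ultimately show ?thesis unfolding unit_in_def by blast
qed

lemma unit_in_PR_degree:
  assumes "unit_in PR x"
  shows "degree x = 0"
proof -
  obtain y where "x * y = 1" using assms by (auto simp: unit_in_def)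
  moreover from this have "x \<noteq> 0" "y \<noteq> 0" by auto
  ultimately show ?thesis using degree_mult_eq[of x y] by simp
qed

text \<open>Factorization over \<open>K\<close> writes \<open>x\<close> and \<open>y\<close> as
  constants times products of the \<open>g i\<close>. These products are monic, so the constants are
  leading coefficients and lie in \<open>R\<close>; their product is \<open>1\<close>, so both have
  valuation \<open>0\<close>.\<close>

lemma PR_factor:
  assumes x: "x \<in> PR" and y: "y \<in> PR" and xy: "x * y = G e"
    and fac: "z \<in> PR" "G e * z = f"
  obtains c d e1 e2 where "c \<in> K" "c \<noteq> 0" "v c = 0" "x = smult c (G e1)"
    "d \<in> K" "d \<noteq> 0" "v d = 0" "y = smult d (G e2)" "\<And>i. i \<le> r \<Longrightarrow> e1 i + e2 i = e i"
proof -
  have K: "x \<in> poly_ring K" "y \<in> poly_ring K" "x * z \<in> poly_ring K" "y * z \<in> poly_ring K"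
    using x y fac(1) PR_closed(4) poly_ring_R_sub_K by auto
  \<comment> \<open>The cofactor \<open>z\<close> is attached to the opposite factor so that both
    products equal \<open>f\<close>, as \<open>divisors_G\<close> expects.\<close>
  have "x * (y * z) = smult 1 (f ^ 1)" "y * (x * z) = smult 1 (f ^ 1)"
  proof -
    have "x * (y * z) = (x * y) * z" "y * (x * z) = (x * y) * z" by (simp_all add: mult_ac)
    then show "x * (y * z) = smult 1 (f ^ 1)" "y * (x * z) = smult 1 (f ^ 1)"
      unfolding xy fac(2) by simp_all
  qed
  then obtain c e1 d e2 where c: "c \<in> K" "c \<noteq> 0" "x = smult c (G e1)"
    and d: "d \<in> K" "d \<noteq> 0" "y = smult d (G e2)"
    using divisors_G[OF K(1,4) K_closed(2) one_neq_zero] divisors_G[OF K(2,3) K_closed(2) one_neq_zero]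
    by metis
  have "lead_coeff x \<in> R" "lead_coeff y \<in> R" using x y by (auto simp: poly_ring_def)
  then have cd: "c \<in> R" "d \<in> R"
    unfolding c(3) d(3) lead_coeff_smult G_monic by simp_all
  have eq: "smult (c * d) (G (\<lambda>i. e1 i + e2 i)) = smult 1 (G e)"
    using xy c d by (simp add: G_add mult.commute)
  then have "c * d = 1" "\<And>i. i \<le> r \<Longrightarrow> e1 i + e2 i = e i"
    using smult_G_inj[OF eq] c(2) d(2) by auto
  moreover have "v c = 0" "v d = 0"
    using v_mult[OF c(1) d(1) c(2) d(2)] \<open>c * d = 1\<close> v_1 cd c(2) d(2)
    by (auto simp: in_R_iff)
  ultimately show thesis using that c d by blast
qed

text \<open>The exponents of two factors add up to the indicator vector of \<open>i\<close>, so
  those of one factor vanish and it is a constant of valuation \<open>0\<close>.\<close>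

lemma g_irred: "i \<le> r \<Longrightarrow> irred_in PR (g i)"
  unfolding irred_in_def
proof (intro conjI ballI impI)
  assume i: "i \<le> r"
  show "g i \<in> PR" using g_R[OF i] .
  show "g i \<noteq> 0" using g_degree[OF i] by auto
  show "\<not> unit_in PR (g i)" using unit_in_PR_degree g_degree[OF i] by fastforce
  fix a b assume ab: "a \<in> PR" "b \<in> PR" "g i = a * b"
  have "a * b = G (\<lambda>j. if j = i then 1 else 0)"
    "G (\<lambda>j. if j = i then 1 else 0) * G (\<lambda>j. if j = i then 0 else 1) = f"
    using ab(3) g_eq_G[OF i] f_split[OF i] by simp_all
  then obtain c d e1 e2 where c: "c \<in> K" "c \<noteq> 0" "v c = 0" "a = smult c (G e1)"
    and d: "d \<in> K" "d \<noteq> 0" "v d = 0" "b = smult d (G e2)"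
    and e: "\<And>j. j \<le> r \<Longrightarrow> e1 j + e2 j = (if j = i then 1 else 0)"
    by (rule PR_factor[OF ab(1,2) _ G_R]) blast
  have "(\<forall>j\<le>r. e1 j = 0) \<or> (\<forall>j\<le>r. e2 j = 0)"
  proof (cases "e1 i = 0")
    case True
    then have "e1 j = 0" if "j \<le> r" for j using e[OF that] by (cases "j = i") auto
    then show ?thesis by blast
  next
    case False
    then have "e2 j = 0" if "j \<le> r" for j using e[OF that] by (cases "j = i") auto
    then show ?thesis by blast
  qed
  then have "G e1 = G (\<lambda>_. 0) \<or> G e2 = G (\<lambda>_. 0)"
    using G_cong[of e1 "\<lambda>_. 0"] G_cong[of e2 "\<lambda>_. 0"] by blast
  then have "a = [:c:] \<or> b = [:d:]" using c d by (auto simp: G_0)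
  then show "unit_in PR a \<or> unit_in PR b"
    using const_unit_in_PR c(1-3) d(1-3) by blast
qed

lemma g_dvd_f: "i \<le> r \<Longrightarrow> dvd_in PR (g i) f"
  unfolding dvd_in_def using f_split G_R g_R f_PR by blast

lemma assoc_g_PR:
  assumes i: "i \<le> r" and u: "u \<in> K" "u \<noteq> 0" "v u = 0"
  shows "assoc_in PR (g i) (smult u (g i))"
proof -
  have "smult u (g i) = g i * [:u:]" "g i = smult u (g i) * [:1 / u:]" using u by auto
  moreover have "[:u:] \<in> PR" "[:1 / u:] \<in> PR"
    using const_unit_in_PR[OF u] const_unit_in_PR[of "1 / u"] u
    by (auto simp: unit_in_def K_divide K_closed v_inverse)
  ultimately show ?thesis
    unfolding assoc_in_def dvd_in_def using g_R[OF i] PR_closed(4) by metis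
qed

text \<open>A nonunit divisor involves some \<open>g i\<close>. Splitting off one copy leaves a
  monic cofactor \<open>G e\<close>, which irreducibility forces to be \<open>1\<close>.\<close>

lemma irred_divisor_form:
  assumes "irred_in PR x" "dvd_in PR x f"
  obtains i u where "i \<le> r" "u \<in> K" "u \<noteq> 0" "v u = 0" "x = smult u (g i)"
proof -
  obtain y where xy: "x \<in> PR" "y \<in> PR" "x * y = G (\<lambda>_. 1)"
    using assms(2) f_eq_G by (auto simp: dvd_in_def)
  obtain c d e1 e2 where c: "c \<in> K" "c \<noteq> 0" "v c = 0" "x = smult c (G e1)"
    by (rule PR_factor[OF xy PR_closed(2)]) (auto simp: f_eq_G)
  have "\<not> unit_in PR x" using assms(1) by (simp add: irred_in_def)
  then have "x \<noteq> [:c:]" using const_unit_in_PR[OF c(1-3)] by auto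
  then have "G e1 \<noteq> 1" using c(4) by auto
  then obtain i where i: "i \<le> r" "e1 i \<noteq> 0" using G_cong[of e1 "\<lambda>_. 0"] G_0
    by metis
  define e where "e j = (if j = i then e1 j - 1 else e1 j)" for j
  have "G e1 = g i * G e"
    unfolding g_eq_G[OF i(1)] G_add[symmetric] using i by (intro G_cong) (auto simp: e_def)
  then have x: "x = smult c (g i) * G e" using c(4) by simp
  moreover have "smult c (g i) \<in> PR" using smult_PR unit_R[OF c(1-3)] g_R[OF i(1)] by blast
  ultimately have "unit_in PR (smult c (g i)) \<or> unit_in PR (G e)"
    using assms(1) G_R unfolding irred_in_def by blast
  moreover have "\<not> unit_in PR (smult c (g i))"
    using unit_in_PR_degree g_degree[OF i(1)] c(2) by fastforce
  ultimately have "degree (G e) = 0" using unit_in_PR_degree by blast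
  then have "G e = 1" using G_monic[of e] by (auto elim!: degree_eq_zeroE simp: one_pCons)
  with x that i c show thesis by simp
qed

lemma assoc_g_inj:
  assumes "i \<le> r" "j \<le> r" "smult c (g i) = smult d (g j)" "c \<noteq> 0"
  shows "i = j"
  using smult_G_inj(2)[of c "\<lambda>k. if k = i then 1 else 0" d "\<lambda>k. if k = j then 1 else 0" i] assms
  by (auto simp: g_eq_G[symmetric] split: if_splits)

text \<open>Reduces an arbitrary choice of representatives to the \<open>g i\<close>: the elements
  of \<open>P\<close> differ from them by constants of valuation \<open>0\<close>, which change no
  valuation of a value.\<close>

lemma irr_divisor_set_form:
  assumes P: "irr_divisor_set PR f P"
  obtains h where "P = h ` {..r}" "inj_on h {..r}"
    "\<And>i. i \<le> r \<Longrightarrow> \<exists>u. u \<in> K \<and> u \<noteq> 0 \<and> v u = 0 \<and> h i = smult u (g i)"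
proof -
  have ex: "\<exists>!y. y \<in> P \<and> assoc_in PR (g i) y" if "i \<le> r" for i
    using P g_irred[OF that] g_dvd_f[OF that] unfolding irr_divisor_set_def by blast
  have form: "\<exists>i u. i \<le> r \<and> u \<in> K \<and> u \<noteq> 0 \<and> v u = 0 \<and> y = smult u (g i)" if "y \<in> P" for y
    using P that irred_divisor_form[of y] unfolding irr_divisor_set_def by metis
  have "\<exists>y. y \<in> P \<and> (\<exists>u. u \<in> K \<and> u \<noteq> 0 \<and> v u = 0 \<and> y = smult u (g i))" if i: "i \<le> r" for i
  proof -
    obtain y where y: "y \<in> P" "assoc_in PR (g i) y" using ex[OF i] by blast
    obtain j u where u: "j \<le> r" "u \<in> K" "u \<noteq> 0" "v u = 0" "y = smult u (g j)"
      using form[OF y(1)] by blast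
    obtain a b where ab: "a \<in> PR" "b \<in> PR" "y = g i * a" "g i = y * b"
      using y(2) unfolding assoc_in_def dvd_in_def by blast
    have nz: "g i \<noteq> 0" using g_degree[OF i] by auto
    have "g i * (a * b) = g i * 1" by (metis ab(3,4) mult.assoc mult_1_right)
    then have "a * b = 1" using nz mult_left_cancel by blast
    then have "unit_in PR a" using ab(1,2) unfolding unit_in_def by blast
    then obtain a' where "a = [:a':]" using unit_in_PR_degree degree_eq_zeroE by metis
    then have "smult u (g j) = smult a' (g i)" using u(5) ab(3) by simp
    then have "j = i" using assoc_g_inj[OF u(1) i] u(3) by blast
    with y u show ?thesis by blast
  qed
  then obtain h where h: "\<And>i. i \<le> r \<Longrightarrow> h i \<in> P"
    "\<And>i. i \<le> r \<Longrightarrow> \<exists>u. u \<in> K \<and> u \<noteq> 0 \<and> v u = 0 \<and> h i = smult u (g i)" by metis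
  have "inj_on h {..r}"
  proof (rule inj_onI)
    fix i j assume "i \<in> {..r}" "j \<in> {..r}" "h i = h j"
    then show "i = j" using h(2)[of i] h(2)[of j] assoc_g_inj by (metis atMost_iff)
  qed
  moreover have "P = h ` {..r}"
  proof
    show "h ` {..r} \<subseteq> P" using h(1) by auto
    show "P \<subseteq> h ` {..r}"
    proof
      fix y assume y: "y \<in> P"
      obtain i u where u: "i \<le> r" "u \<in> K" "u \<noteq> 0" "v u = 0" "y = smult u (g i)"
        using form[OF y] by blast
      have "assoc_in PR (g i) y" using assoc_g_PR[OF u(1-4)] u(5) by simp
      moreover have "assoc_in PR (g i) (h i)" using h(2)[OF u(1)] assoc_g_PR[OF u(1)] by auto
      ultimately have "y = h i" using ex[OF u(1)] y h(1)[OF u(1)] by blast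
      then show "y \<in> h ` {..r}" using u(1) by blast
    qed
  qed
  ultimately show thesis using that h(2) by blast
qed

section \<open>The fixed divisor and the points attaining it\<close>

lemma sum_expo_cases:
  "(\<Sum>i\<le>r. int (expo r n i cl)) = (if r \<le> cl \<and> cl < 2 * r then int n + 1 else int n)"
proof -
  have r1: "r \<ge> 1" using r by simp
  show ?thesis
  proof (rule expo_class_cases[OF r1, of cl])
    assume "cl = 0 \<or> 2 * r \<le> cl"
    from sum_expo_other[OF this r1, of "\<lambda>_. 1 :: int" n] this r1 show ?thesis by auto
  next
    assume "1 \<le> cl" "cl < r"
    from sum_expo_chain[OF this, of "\<lambda>_. 1 :: int" n] this n show ?thesis by simp
  next
    fix j assume "1 \<le> j" "j \<le> r" "cl = r - 1 + j"
    from sum_expo_single[OF this(1,2), of "\<lambda>_. 1 :: int" n] this show ?thesis by auto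
  qed
qed

lemma v_f: "a \<in> R \<Longrightarrow> v (poly f a) = (\<Sum>i\<le>r. v (poly (g i) a))"
  by (simp add: f_eq_G v_G)

lemma v_f_ge: "a \<in> R \<Longrightarrow> int n \<le> v (poly f a)"
proof -
  assume a: "a \<in> R"
  obtain cl where "\<forall>i\<le>r. int (expo r n i cl) \<le> v (poly (g i) a)" using cover[OF a]
    by blast
  then have "(\<Sum>i\<le>r. int (expo r n i cl)) \<le> v (poly f a)"
    unfolding v_f[OF a] by (intro sum_mono) auto
  then show ?thesis unfolding sum_expo_cases by (auto split: if_splits)
qed

lemma v_f_pt: "cl < r \<Longrightarrow> v (poly f (pt cl)) = int n"
  using v_f[OF pt_R, of cl] sum_expo_cases[of cl] v_pt by simp

lemma f_eval_nz: "a \<in> R \<Longrightarrow> poly f a \<noteq> 0"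
  by (simp add: f_eq_G G_eval_nz)

lemma vd_f: "vd R v f = n"
  unfolding vd_def
proof (rule Least_equality)
  have p0: "pt 0 \<in> R" using pt_R[of 0] r by simp
  show "\<exists>a\<in>R. poly f a \<noteq> 0 \<and> v (poly f a) = int n"
    using p0 f_eval_nz[OF p0] v_f_pt[of 0] r by auto
  show "n \<le> k" if "\<exists>a\<in>R. poly f a \<noteq> 0 \<and> v (poly f a) = int k" for k
    using that v_f_ge by fastforce
qed

text \<open>The column supplied by \<open>cover\<close> lies below the valuations at
  \<open>a\<close>, whose sum is \<open>n\<close>. Columns of sum \<open>n + 1\<close> are thereby
  excluded, and for the others equal sums turn every inequality into an equality.\<close>

lemma Wset_form:
  assumes "a \<in> Wset R v f"
  obtains cl where "cl < r \<or> 2 * r \<le> cl" "\<And>i. i \<le> r \<Longrightarrow> v (poly (g i) a) = int (expo r n i cl)"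
proof -
  have a: "a \<in> R" "v (poly f a) = int n" using assms by (auto simp: Wset_def vd_f)
  obtain cl where cl: "\<forall>i\<le>r. int (expo r n i cl) \<le> v (poly (g i) a)"
    using cover[OF a(1)] by blast
  then have le: "(\<Sum>i\<le>r. int (expo r n i cl)) \<le> (\<Sum>i\<le>r. v (poly (g i) a))"
    by (intro sum_mono) auto
  then have "(\<Sum>i\<le>r. int (expo r n i cl)) \<le> int n" using a(2) v_f[OF a(1)] by simp
  then have cl': "\<not> (r \<le> cl \<and> cl < 2 * r)" unfolding sum_expo_cases
    by (auto split: if_splits)
  then have "(\<Sum>i\<le>r. v (poly (g i) a) - int (expo r n i cl)) = 0"
    using a(2) v_f[OF a(1)] sum_expo_cases[of cl] by (auto simp: sum_subtractf)
  then have "\<forall>i\<in>{..r}. v (poly (g i) a) - int (expo r n i cl) = 0"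
    using cl by (subst (asm) sum_nonneg_eq_0_iff) auto
  with cl' that[of cl] show thesis by auto
qed

lemma pt_Wset: "cl < r \<Longrightarrow> pt cl \<in> Wset R v f"
  using pt_R[of cl] f_eval_nz v_f_pt by (simp add: Wset_def vd_f)

text \<open>The kernel vector carried over to polynomials, with entry \<open>0\<close> at
  \<open>h 0\<close>. The sum over indices replaces an inverse of \<open>h\<close> and makes the
  function vanish outside the image of \<open>h\<close>.\<close>

definition spread :: "(nat \<Rightarrow> 'a poly) \<Rightarrow> 'a poly \<Rightarrow> rat" where
  "spread h x = (\<Sum>i=1..r. if h i = x then of_int (al i) else 0)"

context
  fixes P h
  assumes P: "P = h ` {..r}" and h_inj: "inj_on h {..r}"
    and h_unit: "\<And>i. i \<le> r \<Longrightarrow> \<exists>u. u \<in> K \<and> u \<noteq> 0 \<and> v u = 0 \<and> h i = smult u (g i)"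
begin

lemma spread_h: "i \<le> r \<Longrightarrow> spread h (h i) = (if i = 0 then 0 else of_int (al i))"
proof -
  assume i: "i \<le> r"
  have "spread h (h i) = (\<Sum>j=1..r. if j = i then of_int (al j) else 0)"
    unfolding spread_def using h_inj i
    by (intro sum.cong) (auto simp: inj_on_eq_iff)
  then show ?thesis using i by (auto simp: sum.delta)
qed

lemma spread_outside: "x \<notin> P \<Longrightarrow> spread h x = 0"
  unfolding spread_def P by (intro sum.neutral) auto

lemma v_h: "i \<le> r \<Longrightarrow> a \<in> R \<Longrightarrow> v (poly (h i) a) = v (poly (g i) a)"
  using h_unit[of i] by (auto simp: v_mult g_nz g_eval_K)

lemma sum_P: "(\<Sum>x\<in>P. u x * of_int (v (poly x a))) = (\<Sum>i\<le>r. u (h i) * of_int (v (poly (g i) a)))"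
  if "a \<in> R" for u :: "'a poly \<Rightarrow> rat"
  unfolding P using that by (subst sum.reindex[OF h_inj]) (auto simp: v_h)

text \<open>The points \<open>pt cl\<close> with \<open>cl < r\<close> force \<open>w 0 = 0\<close>
  and the recurrence, hence a multiple of the kernel vector. Conversely, by \<open>Wset_form\<close>
  the other points of \<open>Wset R v f\<close> impose no further equations.\<close>

lemma fdk_eq: "fdk R v f P = {\<lambda>x. t * spread h x | t. True}"
proof (intro set_eqI iffI)
  fix u assume "u \<in> fdk R v f P"
  then have out: "\<And>x. x \<notin> P \<Longrightarrow> u x = 0"
    and W: "\<And>a. a \<in> Wset R v f \<Longrightarrow> (\<Sum>x\<in>P. u x * of_int (v (poly x a))) = 0"
    by (auto simp: fdk_def)
  define w where "w i = u (h i)" for i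
  have eq: "(\<Sum>i\<le>r. w i * of_nat (expo r n i cl)) = 0" if "cl < r" for cl
  proof -
    have cl: "cl < 2 * r" using that by simp
    show ?thesis
      using W[OF pt_Wset[OF that]] sum_P[OF pt_R[OF cl]] by (simp add: v_pt[OF _ cl] w_def)
  qed
  have w0: "w 0 = 0" using eq[of 0] sum_expo_other[of 0 r w n] r n by simp
  have rec: "of_nat (n - 1) * w j + w (j + 1) = 0" if "1 \<le> j" "j < r" for j
    using eq[OF that(2)] sum_expo_chain[OF that, of w n] by simp
  define t where "t = of_int (al 1) * w 1"
  have w: "w i = t * of_int (al i)" if "1 \<le> i" "i \<le> r" for i
    using alt_recurrence_unique[of r n w i] rec n that by (simp add: t_def)
  have "u x = t * spread h x" for x
  proof (cases "x \<in> P")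
    case True
    then obtain i where i: "i \<le> r" "x = h i" using P by auto
    then show ?thesis using w[of i] w0 by (auto simp: spread_h w_def)
  qed (simp add: out spread_outside)
  then show "u \<in> {\<lambda>x. t * spread h x | t. True}" by auto
next
  fix u assume "u \<in> {\<lambda>x. t * spread h x | t. True}"
  then obtain t where u: "u = (\<lambda>x. t * spread h x)" by blast
  show "u \<in> fdk R v f P" unfolding fdk_def
  proof (intro CollectI conjI allI impI ballI)
    show "u x = 0" if "x \<notin> P" for x using that by (simp add: u spread_outside)
    fix a assume a: "a \<in> Wset R v f"
    then have aR: "a \<in> R" by (simp add: Wset_def)
    obtain cl where cl: "cl < r \<or> 2 * r \<le> cl"
      "\<And>i. i \<le> r \<Longrightarrow> v (poly (g i) a) = int (expo r n i cl)" by (rule Wset_form[OF a]) blast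
    define w where "w i = (if i = 0 then 0 else t * of_int (al i))" for i
    have "(\<Sum>x\<in>P. u x * of_int (v (poly x a))) = (\<Sum>i\<le>r. w i * of_nat (expo r n i cl))"
      unfolding sum_P[OF aR] using cl(2) by (intro sum.cong) (auto simp: u spread_h w_def)
    also have "\<dots> = 0"
    proof (cases "1 \<le> cl \<and> cl < r")
      case True
      have "of_int (al (cl + 1)) = - (of_nat (n - 1) * of_int (al cl) :: rat)"
      proof -
        have "al (cl + 1) = - (int (n - 1) * al cl)"
          using True alt_Suc[of cl r n] n by (simp add: of_nat_diff algebra_simps)
        then show ?thesis by (simp only: of_int_minus of_int_mult of_int_of_nat_eq)
      qed
      moreover have "w cl = t * of_int (al cl)" "w (cl + 1) = t * of_int (al (cl + 1))"
        using True by (simp_all add: w_def)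
      ultimately have "of_nat (n - 1) * w cl + w (cl + 1) = 0" by simp
      then show ?thesis using True sum_expo_chain[of cl r w n] by simp
    next
      case False
      then show ?thesis using cl(1) sum_expo_other[of cl r w n] r by (auto simp: w_def)
    qed
    finally show "(\<Sum>x\<in>P. u x * of_int (v (poly x a))) = 0" .
  qed
qed

text \<open>The kernel is a line in a space of dimension \<open>r + 1\<close>. The index
  \<open>h 1\<close> serves as \<open>z\<close> because its entry is a sign.\<close>

lemma mat_rank_fdp:
  assumes "is_fdp_matrix R v f P W A" "rows_indep W P A"
  shows "mat_rank W P A = r"
proof -
  have W: "finite W" "mat_kernel W P A = {\<lambda>x. t * spread h x | t. True}"
    using assms(1) fdk_eq by (auto simp: is_fdp_matrix_def)
  have "h 1 \<in> P" "spread h (h 1) \<noteq> 0"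
    using r P spread_h[of 1] alt_one_abs[of r n] by auto
  then have "card W + 1 = card P"
    using rank_nullity_line[OF W(1) _ assms(2) _ _ W(2)] P by simp
  also have "card P = r + 1" unfolding P using card_image[OF h_inj] by simp
  finally show ?thesis using mat_rank_rows_indep[OF W(1) assms(2)] by simp
qed

text \<open>For nonnegative \<open>t\<close> the maximum sits at \<open>h r\<close>, with entry
  \<open>M\<close>; for negative \<open>t\<close> it sits at \<open>h (r - 1)\<close>, with entry
  \<open>- M'\<close>.\<close>

lemma pos_norm_spread:
  "pos_norm P (\<lambda>x. t * spread h x) = (if t \<ge> 0 then t * of_int M else - t * of_int M')"
  unfolding pos_norm_def
proof (rule Max_eqI)
  show "finite (insert 0 ((\<lambda>x. max (t * spread h x) 0) ` P))" unfolding P by simp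
  have M0: "(0::rat) \<le> of_int M" "(0::rat) \<le> of_int M'" using M_ge by simp_all
  have "t * spread h (h i) \<le> (if t \<ge> 0 then t * of_int M else - t * of_int M')" if i: "i \<le> r" for i
  proof (cases "i = 0")
    case True
    then show ?thesis using M0 by (simp add: spread_h mult_nonpos_nonneg)
  next
    case False
    then have "al i \<le> M" "- M' \<le> al i" using al_bounds[of i] i by simp_all
    then have "of_int (al i) \<le> (of_int M :: rat)" "of_int (- M') \<le> (of_int (al i) :: rat)"
      by (simp_all only: of_int_le_iff)
    then have b: "of_int (al i) \<le> (of_int M :: rat)" "- of_int M' \<le> (of_int (al i) :: rat)"
      by simp_all
    show ?thesis
    proof (cases "t \<ge> 0")
      case True
      then show ?thesis using False i b by (simp add: spread_h mult_left_mono)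
    next
      case t: False
      then have "t * of_int (al i) \<le> t * (- of_int M')" using b
        by (intro mult_left_mono_neg) auto
      then show ?thesis using False i t by (simp add: spread_h)
    qed
  qed
  moreover have nn: "0 \<le> (if t \<ge> 0 then t * of_int M else - t * of_int M')"
    using M0 by (auto simp: mult_nonpos_nonneg)
  ultimately show "y \<le> (if t \<ge> 0 then t * of_int M else - t * of_int M')"
    if "y \<in> insert 0 ((\<lambda>x. max (t * spread h x) 0) ` P)" for y
    using that unfolding P by fastforce
  have mem: "h r \<in> P" "h (r - 1) \<in> P" using P by auto
  have val: "spread h (h r) = of_int M" "spread h (h (r - 1)) = - of_int M'"
    using r spread_h[of r] spread_h[of "r - 1"] al_top al_below by auto
  have "(if t \<ge> 0 then t * of_int M else - t * of_int M') =
      max (t * spread h (if t \<ge> 0 then h r else h (r - 1))) 0"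
    using nn val by (auto simp: max_def split: if_splits)
  then show "(if t \<ge> 0 then t * of_int M else - t * of_int M') \<in>
      insert 0 ((\<lambda>x. max (t * spread h x) 0) ` P)"
    using mem by (intro insertI2 image_eqI[of _ _ "if t \<ge> 0 then h r else h (r - 1)"]) auto
qed

lemma neg_norm_eq: "neg_norm P u = pos_norm P (\<lambda>x. - u x)"
  unfolding neg_norm_def pos_norm_def
  by (intro arg_cong[of _ _ Max] arg_cong[of _ _ "insert 0"] image_cong) auto

lemma norms_spread:
  "pos_norm P (\<lambda>x. t * spread h x) + neg_norm P (\<lambda>x. t * spread h x) = \<bar>t\<bar> * of_int (M + M')"
proof -
  have "neg_norm P (\<lambda>x. t * spread h x) = pos_norm P (\<lambda>x. (- t) * spread h x)"
    by (simp add: neg_norm_eq)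
  then show ?thesis unfolding pos_norm_spread by (auto simp: pos_norm_spread algebra_simps)
qed

text \<open>Integral kernel vectors are the integer multiples of the spread vector, and the norm sum
  grows with the absolute value of \<open>t\<close>, so the minimum \<open>M + M'\<close> occurs at
  \<open>t = 1\<close>.\<close>

lemma minimal_norms:
  "\<exists>m. m \<in> {pos_norm P u + neg_norm P u | u. u \<in> fdk R v f P \<and> u \<noteq> (\<lambda>_. 0) \<and> (\<forall>x\<in>P. u x \<in> \<int>)} \<and>
    (\<forall>u. u \<in> fdk R v f P \<and> u \<noteq> (\<lambda>_. 0) \<and> (\<forall>x\<in>P. u x \<in> \<int>) \<longrightarrow> m \<le> pos_norm P u + neg_norm P u) \<and>
    rat_of_nat S = rat_of_nat (n + 1) * m"
proof (intro exI[of _ "of_int (M + M')"] conjI allI impI CollectI)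
  have one: "1 \<le> r" using r by simp
  have h1: "spread h (h 1) = of_int (al 1)" using spread_h[OF one] by simp
  show "\<exists>u. rat_of_int (M + M') = pos_norm P u + neg_norm P u \<and> u \<in> fdk R v f P \<and>
      u \<noteq> (\<lambda>_. 0) \<and> (\<forall>x\<in>P. u x \<in> \<int>)"
  proof (intro exI[of _ "\<lambda>x. 1 * spread h x"] conjI)
    show "rat_of_int (M + M') = pos_norm P (\<lambda>x. 1 * spread h x) + neg_norm P (\<lambda>x. 1 * spread h x)"
      unfolding norms_spread by simp
    show "(\<lambda>x. 1 * spread h x) \<in> fdk R v f P" unfolding fdk_eq by blast
    show "(\<lambda>x. 1 * spread h x) \<noteq> (\<lambda>_. 0)"
      using h1 alt_one_abs[of r n] by (auto dest!: fun_cong[of _ _ "h 1"])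
    show "\<forall>x\<in>P. 1 * spread h x \<in> \<int>" unfolding P by (auto simp: spread_h)
  qed
  fix u assume u: "u \<in> fdk R v f P \<and> u \<noteq> (\<lambda>_. 0) \<and> (\<forall>x\<in>P. u x \<in> \<int>)"
  then obtain t where t: "u = (\<lambda>x. t * spread h x)" unfolding fdk_eq by blast
  \<comment> \<open>The entry at \<open>h 1\<close> is \<open>t\<close> up to sign, so its
    integrality alone makes \<open>t\<close> an integer.\<close>
  have "u (h 1) \<in> \<int>" using u P one by auto
  then have "t * of_int (al 1) * of_int (al 1) \<in> \<int>"
    unfolding t h1 by (rule Ints_mult[OF _ Ints_of_int])
  moreover have "of_int (al 1) * of_int (al 1) = (1 :: rat)"
  proof -
    have "al 1 * al 1 = 1" using alt_one_abs[of r n] by (metis abs_mult_self_eq mult_1)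
    then show ?thesis by (metis of_int_1 of_int_mult)
  qed
  ultimately have "t \<in> \<int>" by (metis mult.assoc mult_1_right)
  moreover have "t \<noteq> 0" using u t by auto
  ultimately have "1 \<le> \<bar>t\<bar>" by (rule Ints_nonzero_abs_ge1)
  then have "1 * rat_of_int (M + M') \<le> \<bar>t\<bar> * rat_of_int (M + M')"
    using M_ge by (intro mult_right_mono) auto
  then show "rat_of_int (M + M') \<le> pos_norm P u + neg_norm P u"
    unfolding t norms_spread by simp
next
  have "rat_of_int (int S) = rat_of_int ((int n + 1) * M' + (int n + 1) * M)" using S_eq by simp
  then show "rat_of_nat S = rat_of_nat (n + 1) * rat_of_int (M + M')" by (simp add: algebra_simps)
qed

end

lemma mat_rank_r:
  "irr_divisor_set PR f P \<Longrightarrow> is_fdp_matrix R v f P W A \<Longrightarrow> rows_indep W P A \<Longrightarrow> mat_rank W P A = r"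
  by (erule irr_divisor_set_form) (rule mat_rank_fdp)

lemma minimal_norms_P:
  "irr_divisor_set PR f P \<Longrightarrow>
    \<exists>m. m \<in> {pos_norm P u + neg_norm P u | u. u \<in> fdk R v f P \<and> u \<noteq> (\<lambda>_. 0) \<and> (\<forall>x\<in>P. u x \<in> \<int>)} \<and>
    (\<forall>u. u \<in> fdk R v f P \<and> u \<noteq> (\<lambda>_. 0) \<and> (\<forall>x\<in>P. u x \<in> \<int>) \<longrightarrow> m \<le> pos_norm P u + neg_norm P u) \<and>
    rat_of_nat S = rat_of_nat (n + 1) * m"
  by (erule irr_divisor_set_form) (rule minimal_norms)

end

section \<open>Integer polynomials\<close>

lemma map_poly_of_int_mult:
  "map_poly of_int (x * y) = (map_poly of_int x * map_poly of_int y :: 'b::comm_ring_1 poly)"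
  by (intro poly_eqI) (simp add: coeff_map_poly coeff_mult)

lemma map_poly_of_int_add:
  "map_poly of_int (x + y) = (map_poly of_int x + map_poly of_int y :: 'b::comm_ring_1 poly)"
  by (intro poly_eqI) (simp add: coeff_map_poly)

lemma map_poly_of_int_pCons:
  "map_poly of_int (pCons c x) = (pCons (of_int c) (map_poly of_int x) :: 'b::comm_ring_1 poly)"
  by (intro poly_eqI) (simp add: coeff_map_poly coeff_pCons split: nat.split)

lemma map_poly_of_int_smult:
  "map_poly of_int (smult c x) = (smult (of_int c) (map_poly of_int x) :: 'b::comm_ring_1 poly)"
  by (intro poly_eqI) (simp add: coeff_map_poly)

lemma map_poly_of_int_power:
  "map_poly of_int (x ^ k) = (map_poly of_int x ^ k :: 'b::comm_ring_1 poly)"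
  by (induction k) (auto simp: map_poly_of_int_mult map_poly_1)

lemma map_poly_of_int_prod:
  "map_poly of_int (prod h A) = (\<Prod>i\<in>A. map_poly of_int (h i) :: 'b::comm_ring_1 poly)"
  by (induction A rule: infinite_finite_induct) (auto simp: map_poly_of_int_mult map_poly_1)

lemma map_poly_of_int_inj:
  "map_poly of_int x = (map_poly of_int y :: 'b::{comm_ring_1,ring_char_0} poly) \<Longrightarrow> x = y"
proof (rule poly_eqI)
  fix i assume "map_poly of_int x = (map_poly of_int y :: 'b poly)"
  then have "coeff (map_poly of_int x) i = (coeff (map_poly of_int y) i :: 'b)" by simp
  then show "coeff x i = coeff y i" by (simp add: coeff_map_poly)
qed

lemma clear_denominators:
  fixes x :: "'a::field_char_0 poly"
  assumes "x \<in> poly_ring \<rat>"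
  shows "\<exists>c X. c \<noteq> 0 \<and> smult (of_int c) x = map_poly of_int X"
  using assms
proof (induction x)
  case 0
  show ?case by (intro exI[of _ 1] exI[of _ 0]) auto
next
  case (pCons a x)
  have "coeff (pCons a x) i \<in> \<rat>" for i using pCons.prems by (simp add: poly_ring_def)
  from this[of 0] this[of "Suc i" for i] have "x \<in> poly_ring \<rat>" "a \<in> \<rat>"
    by (simp_all add: poly_ring_def)
  then obtain c X s t where "c \<noteq> 0" "smult (of_int c) x = map_poly of_int X"
    and st: "t \<noteq> 0" "a = of_int s / of_int t"
    using pCons.IH by (metis Rats_cases' less_irrefl)
  then have "smult (of_int (c * t)) (pCons a x) = map_poly of_int (pCons (c * s) (smult t X))"
    by (simp add: map_poly_of_int_pCons map_poly_of_int_smult mult.commute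
        flip: \<open>smult (of_int c) x = map_poly of_int X\<close>)
  with \<open>c \<noteq> 0\<close> st show ?case by (intro exI[of _ "c * t"]) auto
qed

text \<open>Modulo 2 such a polynomial is a constant times a power of the variable, and this is
  stable under products.\<close>

lemma even_lower_coeffs_mult:
  fixes x y :: "int poly"
  assumes "x \<noteq> 0" "y \<noteq> 0" "\<And>i. i < degree x \<Longrightarrow> even (coeff x i)" "\<And>i. i < degree y \<Longrightarrow> even (coeff y i)"
    and i: "i < degree (x * y)"
  shows "even (coeff (x * y) i)"
  unfolding coeff_mult
proof (rule dvd_sum)
  fix j assume "j \<in> {..i}"
  moreover have "i < degree x + degree y" using assms by (simp add: degree_mult_eq)
  ultimately consider "j < degree x" | "j > degree x" | "i - j < degree y" by fastforce
  then show "even (coeff x j * coeff y (i - j))"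
    by cases (auto simp: assms(3,4) coeff_eq_0)
qed

text \<open>Eisenstein's criterion at 2. If \<open>a\<close> has even constant term, that of
  \<open>b\<close> is odd, and inductively all coefficients of \<open>a\<close> below
  \<open>degree h\<close> are even. The leading coefficient of \<open>a\<close> is odd, so
  \<open>a\<close> takes the whole degree and \<open>b\<close> is a constant unit. Primality follows
  because integer polynomials form a factorial ring.\<close>

lemma eisenstein_2:
  fixes h :: "int poly"
  assumes monic: "lead_coeff h = 1" and deg: "degree h > 0"
    and ev: "\<And>i. i < degree h \<Longrightarrow> even (coeff h i)" and c0: "\<not> 4 dvd coeff h 0"
  shows "prime_elem h"
proof -
  have key: "is_unit b" if ab: "h = a * b" and a0: "even (coeff a 0)" for a b
  proof -
    have h_nz: "h \<noteq> 0" using deg by auto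
    have nz: "a \<noteq> 0" "b \<noteq> 0" using h_nz ab by auto
    have b0: "odd (coeff b 0)"
    proof
      assume "even (coeff b 0)"
      then have "2 * 2 dvd coeff a 0 * coeff b 0" using a0 by (intro mult_dvd_mono)
      then show False using c0 ab by (simp add: coeff_mult)
    qed
    have a_even: "even (coeff a i)" if "i < degree h" for i
      using that
    proof (induction i rule: less_induct)
      case (less i)
      have "coeff h i = (\<Sum>j\<le>i. coeff a j * coeff b (i - j))" using ab
        by (simp add: coeff_mult)
      also have "\<dots> = coeff a i * coeff b 0 + (\<Sum>j<i. coeff a j * coeff b (i - j))"
        by (simp add: lessThan_Suc_atMost[symmetric])
      finally have "even (coeff a i * coeff b 0 + (\<Sum>j<i. coeff a j * coeff b (i - j)))"
        using ev[OF less.prems] by simp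
      moreover have "even (\<Sum>j<i. coeff a j * coeff b (i - j))"
        using less by (intro dvd_sum dvd_mult2) auto
      ultimately have "even (coeff a i * coeff b 0)" by (simp add: even_add)
      with b0 show ?case by simp
    qed
    have lc: "lead_coeff a * lead_coeff b = 1"
      using monic ab by (simp add: lead_coeff_mult)
    then have "odd (lead_coeff a)" by (metis even_mult_iff odd_one)
    then have "\<not> degree a < degree h" using a_even by auto
    moreover have "degree h = degree a + degree b" using ab nz by (simp add: degree_mult_eq)
    ultimately have "degree b = 0" by simp
    then obtain d where d: "b = [:d:]" by (elim degree_eq_zeroE)
    with lc have "d dvd 1" by (metis dvd_triv_right lead_coeff_pCons(2) pCons_0_0 nz(2))
    then show ?thesis unfolding d by (simp add: is_unit_const_poly_iff)
  qed
  have "irreducible h"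
  proof (rule irreducibleI)
    show "h \<noteq> 0" using deg by auto
    show "\<not> is_unit h" using deg by (auto simp: is_unit_poly_iff)
    fix a b assume ab: "h = a * b"
    have "even (coeff a 0 * coeff b 0)" using ev[of 0] deg ab by (simp add: coeff_mult)
    then show "is_unit a \<or> is_unit b"
      using key[OF ab] key[of b a] ab by (auto simp: mult.commute)
  qed
  then show ?thesis by (rule irreducible_imp_prime_elem)
qed

text \<open>Induction on the total exponent: a prime \<open>gi i\<close> on the right divides
  \<open>X\<close> or \<open>Y\<close> and is cancelled there. The constant \<open>D\<close> stays
  unspecified, since it is absorbed into a rational scalar afterwards.\<close>

lemma prime_power_product_divisor:
  fixes gi :: "nat \<Rightarrow> int poly"
  assumes prime: "\<And>i. i \<le> r \<Longrightarrow> prime_elem (gi i)"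
    and "X * Y = [:C:] * (\<Prod>i\<le>r. gi i ^ k i)" "C \<noteq> 0"
  shows "\<exists>D e. X = [:D:] * (\<Prod>i\<le>r. gi i ^ e i)"
  using assms(2)
proof (induction "\<Sum>i\<le>r. k i" arbitrary: X Y k)
  case 0
  then have "X * Y = [:C:]" by simp
  with assms(3) have "X \<noteq> 0" "Y \<noteq> 0" "degree (X * Y) = 0" by auto
  then have "degree X = 0" by (simp add: degree_mult_eq)
  then obtain d where "X = [:d:]" by (elim degree_eq_zeroE)
  then show ?case by (intro exI[of _ d] exI[of _ "\<lambda>_. 0"]) simp
next
  case (Suc m)
  have "\<exists>i\<le>r. k i > 0"
  proof (rule ccontr)
    assume "\<not> (\<exists>i\<le>r. k i > 0)"
    then have "(\<Sum>i\<le>r. k i) = 0" by simp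
    with Suc(2) show False by simp
  qed
  then obtain i where i: "i \<le> r" "k i > 0" by blast
  define k' where "k' = k(i := k i - 1)"
  have "(\<Sum>j\<le>r. k j) = k i + (\<Sum>j\<in>{..r} - {i}. k j)"
    "(\<Sum>j\<le>r. k' j) = k' i + (\<Sum>j\<in>{..r} - {i}. k' j)"
    using i by (simp_all add: sum.remove)
  moreover have "(\<Sum>j\<in>{..r} - {i}. k' j) = (\<Sum>j\<in>{..r} - {i}. k j)"
    by (intro sum.cong) (auto simp: k'_def)
  ultimately have k'm: "m = (\<Sum>j\<le>r. k' j)" using Suc(2) i by (simp add: k'_def)
  have split: "(\<Prod>j\<le>r. gi j ^ (e(i := Suc (e i))) j) = gi i * (\<Prod>j\<le>r. gi j ^ e j)" for e :: "nat \<Rightarrow> nat"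
  proof -
    have "(\<Prod>j\<in>{..r} - {i}. gi j ^ (e(i := Suc (e i))) j) = (\<Prod>j\<in>{..r} - {i}. gi j ^ e j)"
      by (intro prod.cong) auto
    then show ?thesis using i by (simp add: prod.remove[of "{..r}" i] mult.assoc)
  qed
  have "k = k'(i := Suc (k' i))" using i by (auto simp: k'_def)
  then have prod: "(\<Prod>j\<le>r. gi j ^ k j) = gi i * (\<Prod>j\<le>r. gi j ^ k' j)"
    using split[of k'] by simp
  have gi: "prime_elem (gi i)" "gi i \<noteq> 0" using prime[OF i(1)] by auto
  have "gi i dvd X * Y" unfolding Suc.prems prod by (rule dvd_mult[OF dvd_triv_left])
  then consider "gi i dvd X" | "gi i dvd Y" using gi(1) by (auto simp: prime_elem_dvd_mult_iff)
  then show ?case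
  proof cases
    case 1
    then obtain X' where X: "X = gi i * X'" by (elim dvdE)
    then have "gi i * (X' * Y) = gi i * ([:C:] * (\<Prod>j\<le>r. gi j ^ k' j))"
      using Suc.prems prod by (simp only: mult_ac)
    then have "X' * Y = [:C:] * (\<Prod>j\<le>r. gi j ^ k' j)" using gi(2) mult_left_cancel by blast
    then obtain D e where "X' = [:D:] * (\<Prod>j\<le>r. gi j ^ e j)" using Suc(1)[OF k'm] by blast
    then have "X = [:D:] * (\<Prod>j\<le>r. gi j ^ (e(i := Suc (e i))) j)"
      unfolding X split by (simp only: mult_ac)
    then show ?thesis by blast
  next
    case 2
    then obtain Y' where Y: "Y = gi i * Y'" by (elim dvdE)
    then have "gi i * (X * Y') = gi i * ([:C:] * (\<Prod>j\<le>r. gi j ^ k' j))"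
      using Suc.prems prod by (simp only: mult_ac)
    then have "X * Y' = [:C:] * (\<Prod>j\<le>r. gi j ^ k' j)" using gi(2) mult_left_cancel by blast
    then show ?thesis using Suc(1)[OF k'm] by blast
  qed
qed

text \<open>Clearing denominators moves the equation to integer polynomials, where the primes
  \<open>gi i\<close> control the divisors; the integer constants return as the scalar
  \<open>d\<close>.\<close>

lemma rational_divisors:
  fixes gi :: "nat \<Rightarrow> int poly" and x y :: "'a::field_char_0 poly"
  defines "g \<equiv> \<lambda>i. map_poly of_int (gi i)"
  assumes prime: "\<And>i. i \<le> r \<Longrightarrow> prime_elem (gi i)"
    and x: "x \<in> poly_ring \<rat>" and y: "y \<in> poly_ring \<rat>" and c: "c \<in> \<rat>" "c \<noteq> 0"
    and xy: "x * y = smult c ((\<Prod>i\<le>r. g i) ^ k)"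
  shows "\<exists>d e. d \<in> \<rat> \<and> d \<noteq> 0 \<and> x = smult d (\<Prod>i\<le>r. g i ^ e i)"
proof -
  have hom: "map_poly of_int (\<Prod>i\<le>r. gi i ^ e i) = (\<Prod>i\<le>r. g i ^ e i)" for e
    by (simp add: g_def map_poly_of_int_prod map_poly_of_int_power)
  obtain a X where a: "a \<noteq> 0" "smult (of_int a) x = map_poly of_int X"
    using clear_denominators[OF x] by blast
  obtain b Y where b: "b \<noteq> 0" "smult (of_int b) y = map_poly of_int Y"
    using clear_denominators[OF y] by blast
  obtain s t where st: "t \<noteq> 0" "c = of_int s / of_int t" using c(1)
    by (metis Rats_cases' less_irrefl)
  with c have s: "s \<noteq> 0" by auto
  have "map_poly of_int (smult t X * Y) = smult (of_int t) (smult (of_int a) x) * smult (of_int b) y"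
    by (simp add: map_poly_of_int_mult map_poly_of_int_smult a b)
  also have "\<dots> = smult (of_int (t * a * b)) (x * y)" by (simp add: mult_ac)
  also have "\<dots> = smult (of_int (s * a * b)) ((\<Prod>i\<le>r. g i) ^ k)"
    using st by (simp add: xy mult_ac)
  also have "(\<Prod>i\<le>r. g i) ^ k = map_poly of_int (\<Prod>i\<le>r. gi i ^ k)"
    by (simp add: hom prod_power_distrib)
  also have "smult (of_int (s * a * b)) \<dots> = map_poly of_int ([:s * a * b:] * (\<Prod>i\<le>r. gi i ^ k))"
    by (simp add: map_poly_of_int_smult)
  finally have "smult t X * Y = [:s * a * b:] * (\<Prod>i\<le>r. gi i ^ k)"
    by (rule map_poly_of_int_inj)
  then have "\<exists>D e. smult t X = [:D:] * (\<Prod>i\<le>r. gi i ^ e i)"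
    by (rule prime_power_product_divisor[rotated]) (use prime s a b in auto)
  then obtain D e where D: "smult t X = [:D:] * (\<Prod>i\<le>r. gi i ^ e i)" by blast
  have "smult (of_int (t * a)) x = map_poly of_int (smult t X)"
    by (simp add: map_poly_of_int_smult a(2)[symmetric] mult_ac)
  also have "\<dots> = smult (of_int D) (\<Prod>i\<le>r. g i ^ e i)"
    unfolding D by (simp add: map_poly_of_int_smult hom)
  finally have "smult (1 / of_int (t * a)) (smult (of_int (t * a)) x) =
      smult (1 / of_int (t * a)) (smult (of_int D) (\<Prod>i\<le>r. g i ^ e i))" by simp
  then have x_eq: "x = smult (of_int D / of_int (t * a)) (\<Prod>i\<le>r. g i ^ e i)"
    using st a by simp
  have "gi i \<noteq> 0" if "i \<le> r" for i using prime[OF that] by auto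
  then have "g i \<noteq> 0" if "i \<le> r" for i
    using that map_poly_of_int_inj[of "gi i" 0] unfolding g_def by auto
  then have "x * y \<noteq> 0" unfolding xy using c by auto
  then have "x \<noteq> 0" by auto
  with x_eq have "D \<noteq> 0" by auto
  then show ?thesis using x_eq st a
    by (intro exI[of _ "of_int D / of_int (t * a)"] exI[of _ e]) auto
qed

section \<open>The rational numbers with a p-adic valuation\<close>

text \<open>Independence of the chosen fraction is \<open>padic_fraction\<close>. No fraction
  qualifies for \<open>0\<close>, which is why \<open>localization\<close> treats \<open>0\<close>
  separately.\<close>

definition padic :: "nat \<Rightarrow> 'a::field_char_0 \<Rightarrow> int" where
  "padic q z = (THE k. \<exists>a b :: int. a \<noteq> 0 \<and> b \<noteq> 0 \<and> z = of_int a / of_int b \<and>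
    k = int (multiplicity (int q) a) - int (multiplicity (int q) b))"

definition localization :: "nat \<Rightarrow> 'a::field_char_0 set" where
  "localization q = {x \<in> \<rat>. x = 0 \<or> 0 \<le> padic q x}"

lemma padic_fraction:
  assumes "prime q" "a \<noteq> 0" "b \<noteq> 0"
  shows "padic q (of_int a / of_int b :: 'a::field_char_0) =
    int (multiplicity (int q) a) - int (multiplicity (int q) b)"
  unfolding padic_def
proof (rule the_equality)
  fix k assume "\<exists>c d. c \<noteq> 0 \<and> d \<noteq> 0 \<and> of_int a / of_int b = (of_int c / of_int d :: 'a) \<and>
    k = int (multiplicity (int q) c) - int (multiplicity (int q) d)"
  then obtain c d where cd: "c \<noteq> 0" "d \<noteq> 0" "of_int a / of_int b = (of_int c / of_int d :: 'a)"
    and k: "k = int (multiplicity (int q) c) - int (multiplicity (int q) d)" by blast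
  then have "(of_int (a * d) :: 'a) = of_int (c * b)" using assms by (simp add: field_simps)
  then have "a * d = c * b" by (simp only: of_int_eq_iff)
  then have "multiplicity (int q) (a * d) = multiplicity (int q) (c * b)" by simp
  then show "k = int (multiplicity (int q) a) - int (multiplicity (int q) b)"
    using assms cd k by (simp add: prime_elem_multiplicity_mult_distrib)
qed (use assms in blast)

lemma padic_of_int: "prime q \<Longrightarrow> a \<noteq> 0 \<Longrightarrow> padic q (of_int a :: 'a::field_char_0) = int (multiplicity (int q) a)"
  using padic_fraction[of q a 1] by simp

lemma Rats_nonzero_cases:
  assumes "x \<in> \<rat>" "x \<noteq> (0::'a::field_char_0)"
  obtains a b :: int where "a \<noteq> 0" "b \<noteq> 0" "coprime a b" "x = of_int a / of_int b"
  using assms by (metis Rats_cases' div_0 less_irrefl of_int_0)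

lemma padic_mult:
  assumes "prime q" "x \<in> \<rat>" "y \<in> \<rat>" "x \<noteq> 0" "y \<noteq> (0::'a::field_char_0)"
  shows "padic q (x * y) = padic q x + padic q y"
proof -
  obtain a b where ab: "a \<noteq> 0" "b \<noteq> 0" "x = of_int a / of_int b"
    using Rats_nonzero_cases[OF assms(2,4)] by metis
  obtain c d where cd: "c \<noteq> 0" "d \<noteq> 0" "y = of_int c / of_int d"
    using Rats_nonzero_cases[OF assms(3,5)] by metis
  have "x * y = of_int (a * c) / of_int (b * d)" using ab cd by simp
  then show ?thesis
    using padic_fraction[OF assms(1), of "a * c" "b * d"] ab cd assms(1)
    by (simp add: padic_fraction prime_elem_multiplicity_mult_distrib del: of_int_mult)
qed

lemma padic_add:
  assumes "prime q" "x \<in> \<rat>" "y \<in> \<rat>" "x \<noteq> 0" "y \<noteq> 0" "x + y \<noteq> (0::'a::field_char_0)"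
  shows "min (padic q x) (padic q y) \<le> padic q (x + y)"
proof -
  obtain a b where ab: "a \<noteq> 0" "b \<noteq> 0" "x = of_int a / of_int b"
    using Rats_nonzero_cases[OF assms(2,4)] by metis
  obtain c d where cd: "c \<noteq> 0" "d \<noteq> 0" "y = of_int c / of_int d"
    using Rats_nonzero_cases[OF assms(3,5)] by metis
  have xy: "x + y = of_int (a * d + c * b) / of_int (b * d)" using ab cd by (simp add: field_simps)
  have nz: "a * d + c * b \<noteq> 0"
  proof
    assume "a * d + c * b = 0"
    with xy assms(6) show False by (simp del: of_int_add of_int_mult)
  qed
  let ?m = "multiplicity (int q)"
  let ?k = "min (?m (a * d)) (?m (c * b))"
  have "int q ^ ?k dvd a * d + c * b"
    by (intro dvd_add multiplicity_dvd') auto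
  then have "?k \<le> ?m (a * d + c * b)"
    using nz assms(1) by (intro multiplicity_geI) auto
  moreover have "padic q (x + y) = int (?m (a * d + c * b)) - (int (?m b) + int (?m d))"
    unfolding xy using padic_fraction[OF assms(1) nz, of "b * d", where 'a = 'a] ab cd assms(1)
    by (simp add: prime_elem_multiplicity_mult_distrib del: of_int_mult of_int_add)
  moreover have "padic q x = int (?m a) - int (?m b)" "padic q y = int (?m c) - int (?m d)"
    unfolding ab(3) cd(3) using padic_fraction[OF assms(1)] ab cd by blast+
  ultimately show ?thesis
    using ab cd assms(1)
    by (simp add: prime_elem_multiplicity_mult_distrib min_def split: if_splits)
qed


lemma localization_of_int: "prime q \<Longrightarrow> of_int z \<in> (localization q :: 'a::field_char_0 set)"
  by (cases "z = 0") (auto simp: localization_def padic_of_int)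

lemma valuation_Rats:
  assumes q: "prime q"
  shows "valuation \<rat> (localization q) (of_nat q :: 'a::field_char_0) (padic q)"
proof
  let ?R = "localization q :: 'a set"
  have R_int: "of_int z \<in> ?R" for z by (rule localization_of_int[OF q])
  have "multiplicity (int q) (int q) = 1"
    using q by (intro multiplicity_self) auto
  then have v_q: "padic q (of_nat q :: 'a) = 1"
    using padic_of_int[OF q, of "int q", where 'a = 'a] q by (auto simp: prime_gt_0_nat)
  have frac: "\<rat> = {a / b | a b. a \<in> ?R \<and> b \<in> ?R \<and> b \<noteq> 0}"
  proof (intro equalityI subsetI)
    fix x :: 'a assume "x \<in> \<rat>"
    then obtain a b :: int where "b > 0" "x = of_int a / of_int b" by (metis Rats_cases')
    then show "x \<in> {a / b | a b. a \<in> ?R \<and> b \<in> ?R \<and> b \<noteq> 0}"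
      by (intro CollectI exI[of _ "of_int a"] exI[of _ "of_int b"]) (use R_int in auto)
  qed (auto simp: localization_def)
  show "dvr \<rat> ?R (of_nat q) (padic q)"
    unfolding dvr_def
  proof (intro conjI frac)
    show "subfield (\<rat> :: 'a set)" by (auto simp: subfield_def)
    show "of_nat q \<in> ?R" using R_int[of "int q"] by simp
    show "(of_nat q :: 'a) \<noteq> 0" using q by (auto simp: prime_gt_0_nat)
  qed (use q v_q padic_mult padic_add in \<open>auto simp: localization_def\<close>)
qed

text \<open>The even numbers \<open>2 * c\<close> represent all residue classes because 2 is
  invertible modulo the odd prime \<open>q\<close>. Even representatives are what later makes the
  polynomials Eisenstein at 2.\<close>

lemma localization_residue:
  fixes x :: "'a::field_char_0"
  assumes q: "prime q" "q > 2" and x: "x \<in> localization q"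
  obtains c y where "c < q" "y \<in> localization q" "x = of_nat (2 * c) + of_nat q * y"
proof -
  interpret valuation "\<rat> :: 'a set" "localization q" "of_nat q" "padic q" by (rule valuation_Rats[OF q(1)])
  have qi: "prime (int q)" using q(1) by simp
  obtain a b :: int where ab: "\<not> int q dvd b" "x = of_int a / of_int b"
  proof (cases "x = 0")
    case True
    have "\<not> int q dvd 1" using q(1) by (auto simp: zdvd1_eq)
    with True that[of 1 0] show thesis by simp
  next
    case False
    then obtain a b where ab: "a \<noteq> 0" "b \<noteq> 0" "coprime a b" "x = of_int a / of_int b"
      using x Rats_nonzero_cases[of x] by (auto simp: localization_def)
    have "\<not> int q dvd b"
    proof
      assume d: "int q dvd b"
      then have "\<not> int q dvd a" using ab(3) qi not_prime_unit coprime_common_divisor by blast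
      then have "multiplicity (int q) a = 0" by (rule not_dvd_imp_multiplicity_0)
      moreover have "multiplicity (int q) b > 0"
        using d ab(2) qi by (simp add: prime_multiplicity_gt_zero_iff)
      ultimately have "padic q x < 0" unfolding ab(4) padic_fraction[OF q(1) ab(1,2)] by simp
      then show False using x False by (simp add: localization_def)
    qed
    with that ab show thesis by blast
  qed
  have b: "b \<noteq> 0" using ab(1) by auto
  have "\<not> int q dvd 2 * b"
  proof
    assume "int q dvd 2 * b"
    then have "int q dvd 2" using ab(1) qi by (simp add: prime_dvd_mult_iff)
    then show False using q(2) zdvd_imp_le[of "int q" 2] by simp
  qed
  then have "coprime (2 * b) (int q)" using qi prime_imp_coprime[of "int q" "2 * b"]
    by (simp add: coprime_commute)
  \<comment> \<open>\<open>z\<close> inverts \<open>2 * b\<close> modulo \<open>q\<close>, so the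
    residue \<open>c\<close> of \<open>a * z\<close> satisfies \<open>2 * b * c = a\<close> modulo
    \<open>q\<close>.\<close>
  then obtain z where z: "[2 * b * z = 1] (mod int q)" using cong_solve_coprime_int by blast
  define c where "c = nat ((a * z) mod int q)"
  have q0: "int q > 0" using q(2) by simp
  have c: "c < q" "int c = (a * z) mod int q" using q0 by (auto simp: c_def nat_less_iff)
  have "[2 * b * int c = 2 * b * (a * z)] (mod int q)"
    unfolding c(2) by (intro cong_mult) auto
  also have "2 * b * (a * z) = a * (2 * b * z)" by simp
  also have "[a * (2 * b * z) = a * 1] (mod int q)" by (intro cong_mult z cong_refl)
  finally have "int q dvd a - 2 * b * int c" by (simp add: cong_iff_dvd_diff dvd_diff_commute)
  then obtain m where m: "a - 2 * b * int c = int q * m" by (elim dvdE)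
  have "of_int m / of_int b \<in> (localization q :: 'a set)"
  proof (cases "m = 0")
    case False
    have "multiplicity (int q) b = 0" using ab(1) by (rule not_dvd_imp_multiplicity_0)
    then show ?thesis
      using padic_fraction[OF q(1) False b, where 'a = 'a] by (simp add: localization_def)
  qed (simp add: localization_def)
  moreover have "x = of_nat (2 * c) + of_nat q * (of_int m / of_int b)"
  proof -
    have "of_int a = (of_int (2 * b * int c + int q * m) :: 'a)" using m
      by (metis diff_add_cancel add.commute)
    then have "of_int a = 2 * of_int b * of_nat c + of_nat q * (of_int m :: 'a)" by simp
    then show ?thesis using ab(2) b by (simp add: field_simps)
  qed
  ultimately show thesis using that c(1) by blast
qed

lemma finite_residue_field_localization:
  assumes q: "prime q" "q > 2"
  shows "finite_residue_field (localization q :: 'a::field_char_0 set) (of_nat q)"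
proof -
  let ?R = "localization q :: 'a set"
  let ?I = "principal_ideal ?R (of_nat q)"
  interpret valuation "\<rat> :: 'a set" "localization q" "of_nat q" "padic q" by (rule valuation_Rats[OF q(1)])
  have m1: "- 1 \<in> ?R"
    using padic_of_int[OF q(1), of "- 1", where 'a = 'a] by (simp add: localization_def)
  have I_add: "x + y \<in> ?I" if "x \<in> ?I" "y \<in> ?I" for x y
    using that unfolding principal_ideal_def by (auto simp flip: distrib_left intro: R_closed)
  have I_minus: "- x \<in> ?I" if x: "x \<in> ?I" for x
  proof -
    obtain y where "y \<in> ?R" "x = of_nat q * y" using x by (auto simp: principal_ideal_def)
    then have "- x = of_nat q * (- 1 * y)" "- 1 * y \<in> ?R" using R_closed(4)[OF m1] by auto
    then show ?thesis unfolding principal_ideal_def by blast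
  qed
  have "{{b \<in> ?R. a - b \<in> ?I} | a. a \<in> ?R} \<subseteq> (\<lambda>c. {b \<in> ?R. of_nat (2 * c) - b \<in> ?I}) ` {..<q}"
  proof
    fix s assume "s \<in> {{b \<in> ?R. a - b \<in> ?I} | a. a \<in> ?R}"
    then obtain a where a: "a \<in> ?R" "s = {b \<in> ?R. a - b \<in> ?I}" by blast
    obtain c y where c: "c < q" "y \<in> ?R" "a = of_nat (2 * c) + of_nat q * y"
      by (rule localization_residue[OF q a(1)])
    have y: "of_nat q * y \<in> ?I" using c(2) by (auto simp: principal_ideal_def)
    have "a - b \<in> ?I \<longleftrightarrow> of_nat (2 * c) - b \<in> ?I" for b
    proof
      assume "a - b \<in> ?I"
      then have "(a - b) + - (of_nat q * y) \<in> ?I" using I_add I_minus y by blast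
      then show "of_nat (2 * c) - b \<in> ?I" by (simp add: c(3))
    next
      assume "of_nat (2 * c) - b \<in> ?I"
      then have "(of_nat (2 * c) - b) + of_nat q * y \<in> ?I" using I_add y by blast
      then show "a - b \<in> ?I" by (simp add: c(3) algebra_simps)
    qed
    then show "s \<in> (\<lambda>c. {b \<in> ?R. of_nat (2 * c) - b \<in> ?I}) ` {..<q}"
      using a c(1) by auto
  qed
  then show ?thesis unfolding finite_residue_field_def by (rule finite_subset) simp
qed

section \<open>The polynomials realizing the exponent pattern\<close>

text \<open>The bound on \<open>q\<close> leaves room for \<open>2 * r\<close> distinct residue
  classes, and makes \<open>q\<close> odd.\<close>

locale eisenstein_pattern =
  fixes q r n :: nat
  assumes prime_q: "prime q" and q_gt: "2 * r < q" and r: "r \<ge> 2" and n: "n \<ge> 2"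
begin

definition base :: "nat \<Rightarrow> int poly" where
  "base i = (\<Prod>c<q. [:- int (2 * c), 1:] ^ expo r n i c)"

text \<open>The added constant plays two roles. It is even but not divisible by 4, as Eisenstein at
  2 requires; and its \<open>q\<close>-adic valuation \<open>n + 2\<close> exceeds every exponent in
  the table, so it does not disturb the pattern.\<close>

definition gi :: "nat \<Rightarrow> int poly" where
  "gi i = base i + [:2 * int q ^ (n + 2):]"

definition g :: "nat \<Rightarrow> complex poly" where
  "g i = map_poly of_int (gi i)"

sublocale valuation "\<rat> :: complex set" "localization q" "of_nat q" "padic q"
  by (rule valuation_Rats[OF prime_q])

abbreviation R where "R \<equiv> localization q :: complex set"

lemma q_gt_2: "q > 2" using q_gt r by simp

lemma q_odd: "odd q" using prime_q q_gt_2 prime_odd_nat by blast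

lemma degree_base: "degree (base i) = (\<Sum>c<q. expo r n i c)"
proof -
  have "degree (base i) = (\<Sum>c<q. degree ([:- int (2 * c), 1:] ^ expo r n i c))"
    unfolding base_def by (rule degree_prod_eq_sum_degree) simp
  then show ?thesis by (simp add: degree_power_eq)
qed

text \<open>Column \<open>0\<close> supplies \<open>n\<close> for \<open>g 0\<close>, and column
  \<open>r - 1 + i\<close> supplies \<open>n + 1\<close> for the others. The bound makes the
  constant term of \<open>base i\<close> divisible by 4 and keeps the \<open>g i\<close> from being
  linear.\<close>

lemma degree_base_ge:
  assumes "i \<le> r"
  shows "degree (base i) \<ge> 2"
proof -
  obtain c where c: "c < q" "expo r n i c \<ge> 2"
  proof (cases "i = 0")
    case True
    then show thesis using that[of 0] n q_gt r by (auto simp: expo_def)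
  next
    case False
    then have "r - 1 + i < q" "expo r n i (r - 1 + i) = n + 1" using assms q_gt r
      by (auto simp: expo_def)
    then show thesis using that n by force
  qed
  have "expo r n i c \<le> (\<Sum>c<q. expo r n i c)" using c(1) by (intro member_le_sum) auto
  with c(2) show ?thesis by (simp add: degree_base)
qed

lemma base_monic: "lead_coeff (base i) = 1"
  by (simp add: base_def lead_coeff_prod lead_coeff_power)

lemma base_even:
  assumes "k < degree (base i)"
  shows "even (coeff (base i) k)"
proof -
  have power: "\<forall>k. k < degree ([:- int (2 * c), 1:] ^ m) \<longrightarrow> even (coeff ([:- int (2 * c), 1:] ^ m) k)" for c m
  proof (induction m)
    case (Suc m)
    show ?case unfolding power_Suc
      by (intro allI impI even_lower_coeffs_mult) (use Suc in \<open>auto simp: degree_power_eq\<close>)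
  qed simp
  have "\<forall>k. k < degree (\<Prod>c\<in>A. [:- int (2 * c), 1:] ^ expo r n i c) \<longrightarrow>
      even (coeff (\<Prod>c\<in>A. [:- int (2 * c), 1:] ^ expo r n i c) k)" if "finite A" for A
    using that
  proof (induction A rule: finite_induct)
    case (insert c A)
    show ?case unfolding prod.insert[OF insert(1,2)]
      by (intro allI impI even_lower_coeffs_mult) (use insert power in auto)
  qed simp
  from this[of "{..<q}"] assms show ?thesis unfolding base_def by blast
qed

lemma base_0: "i \<le> r \<Longrightarrow> 4 dvd coeff (base i) 0"
proof -
  assume i: "i \<le> r"
  have "(\<Prod>c<q. (2::int) ^ expo r n i c) dvd (\<Prod>c<q. (- int (2 * c)) ^ expo r n i c)"
    by (intro prod_dvd_prod dvd_power_same) auto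
  moreover have "(\<Prod>c<q. (2::int) ^ expo r n i c) = 2 ^ degree (base i)"
    by (simp add: power_sum degree_base)
  moreover have "coeff (base i) 0 = (\<Prod>c<q. (- int (2 * c)) ^ expo r n i c)"
    by (simp add: base_def flip: poly_0_coeff_0) (simp add: poly_prod)
  moreover have "(4::int) dvd 2 ^ degree (base i)"
    using le_imp_power_dvd[OF degree_base_ge[OF i], of "2::int"] by simp
  ultimately show ?thesis by (metis dvd_trans)
qed

lemma degree_gi: "i \<le> r \<Longrightarrow> degree (gi i) = degree (base i)"
  unfolding gi_def using degree_base_ge[of i] by (intro degree_add_eq_left) simp

lemma gi_monic: "i \<le> r \<Longrightarrow> lead_coeff (gi i) = 1"
  using degree_gi[of i] degree_base_ge[of i] base_monic[of i]
  by (cases "degree (base i)") (auto simp: gi_def coeff_pCons)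

lemma prime_gi:
  assumes i: "i \<le> r"
  shows "prime_elem (gi i)"
proof (rule eisenstein_2)
  show "lead_coeff (gi i) = 1" using gi_monic[OF i] .
  show "degree (gi i) > 0" using degree_gi[OF i] degree_base_ge[OF i] by simp
  show "even (coeff (gi i) k)" if "k < degree (gi i)" for k
    using base_even[of k i] that degree_gi[OF i] by (auto simp: gi_def coeff_pCons split: nat.split)
  show "\<not> 4 dvd coeff (gi i) 0"
  proof
    assume "4 dvd coeff (gi i) 0"
    then have "4 dvd coeff (base i) 0 + 2 * int q ^ (n + 2)" by (simp add: gi_def)
    then have "4 dvd 2 * int q ^ (n + 2)" using base_0[OF i] dvd_add_right_iff by blast
    then have "2 * 2 dvd 2 * int q ^ (n + 2)" by simp
    then have "even (int q ^ (n + 2))" by (simp only: dvd_mult_cancel_left) simp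
    then show False using q_odd by simp
  qed
qed

lemma g_eval:
  "poly (g i) z = (\<Prod>c<q. (z - of_nat (2 * c)) ^ expo r n i c) + 2 * of_nat q ^ (n + 2)"
  unfolding g_def gi_def base_def
  by (simp add: map_poly_of_int_add map_poly_of_int_prod map_poly_of_int_power map_poly_of_int_pCons
      poly_prod algebra_simps)

lemma R_of_int: "of_int z \<in> R"
  by (rule localization_of_int[OF prime_q])

lemma g_R: "g i \<in> poly_ring R"
  using R_of_int by (auto simp: poly_ring_def g_def coeff_map_poly)

lemma degree_g: "degree (g i) = degree (gi i)"
  unfolding g_def by (rule degree_map_poly) auto

lemma g_monic: "i \<le> r \<Longrightarrow> lead_coeff (g i) = 1"
  using gi_monic[of i] unfolding degree_g by (simp add: g_def coeff_map_poly)

lemma synthetic_div_Rats: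
  fixes x :: "complex poly"
  shows "a \<in> \<rat> \<Longrightarrow> x \<in> poly_ring \<rat> \<Longrightarrow> synthetic_div x a \<in> poly_ring \<rat>"
proof (induction x)
  case (pCons b x)
  have "coeff (pCons b x) k \<in> \<rat>" for k using pCons.prems by (simp add: poly_ring_def)
  from this[of "Suc k" for k] have x: "x \<in> poly_ring \<rat>" by (simp add: poly_ring_def)
  then have "poly x a \<in> \<rat>" using poly_ring_eval[OF subsemiring_K] pCons.prems by blast
  with pCons.IH[OF pCons.prems(1) x] show ?case
    by (auto simp: poly_ring_def coeff_pCons split: nat.split)
qed (simp add: poly_ring_def)

lemma divisors:
  assumes "x \<in> poly_ring \<rat>" "y \<in> poly_ring \<rat>" "c \<in> \<rat>" "c \<noteq> 0" "x * y = smult c ((\<Prod>i\<le>r. g i) ^ k)"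
  shows "\<exists>d e. d \<in> \<rat> \<and> d \<noteq> 0 \<and> x = smult d (\<Prod>i\<le>r. g i ^ e i)"
  unfolding g_def by (rule rational_divisors[OF _ assms(1-4) assms(5)[unfolded g_def]]) (rule prime_gi)

text \<open>A root in \<open>R\<close> would give a linear divisor of the product over the
  rationals, but by \<open>divisors\<close> every divisor is a scalar times a product of the
  \<open>g j\<close>, all of degree at least 2.\<close>

lemma g_nz:
  assumes i: "i \<le> r" and a: "a \<in> R"
  shows "poly (g i) a \<noteq> 0"
proof
  assume root: "poly (g i) a = 0"
  have aK: "a \<in> \<rat>" using a by (simp add: localization_def)
  have gK: "g j \<in> poly_ring \<rat>" for j using poly_ring_R_sub_K[OF g_R] .
  let ?h = "synthetic_div (g i) a"
  have "g i = [:- a, 1:] * ?h" using synthetic_div_correct'[of a "g i"] root by simp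
  then have "[:- a, 1:] * (?h * (\<Prod>j\<in>{..r} - {i}. g j)) = smult 1 ((\<Prod>j\<le>r. g j) ^ 1)"
    using i by (simp add: prod.remove[of "{..r}" i] mult.assoc del: mult_pCons_left)
  moreover have "[:- a, 1:] \<in> poly_ring \<rat>"
    using aK by (auto simp: poly_ring_def coeff_pCons split: nat.split)
  moreover have "?h * (\<Prod>j\<in>{..r} - {i}. g j) \<in> poly_ring \<rat>"
    using subsemiringD(4)[OF subsemiring_poly_ring[OF subsemiring_K]] synthetic_div_Rats[OF aK gK]
      subsemiring_prod[OF subsemiring_poly_ring[OF subsemiring_K], of "{..r} - {i}" g] gK by blast
  ultimately obtain d e where d: "d \<noteq> 0" "[:- a, 1:] = smult d (\<Prod>j\<le>r. g j ^ e j)"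
    using divisors[of "[:- a, 1:]" "?h * (\<Prod>j\<in>{..r} - {i}. g j)" 1 1] by auto
  have gnz: "g j \<noteq> 0" if "j \<le> r" for j using g_monic[OF that] by auto
  have "1 = degree (\<Prod>j\<le>r. g j ^ e j)" using d
    by (metis degree_pCons_eq_if degree_smult_eq one_neq_zero pCons_eq_0_iff degree_0 One_nat_def)
  also have "\<dots> = (\<Sum>j\<le>r. e j * degree (g j))"
    using gnz by (subst degree_prod_sum_eq) (auto simp: degree_power_eq)
  finally have sum: "(\<Sum>j\<le>r. e j * degree (g j)) = 1" by simp
  have "\<not> (\<forall>j\<in>{..r}. e j * degree (g j) = 0)"
    using sum sum.neutral[of "{..r}" "\<lambda>j. e j * degree (g j)"] by linarith
  then obtain j where j: "j \<le> r" "e j * degree (g j) \<noteq> 0" by blast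
  then have "e j * degree (g j) \<le> 1"
    using sum member_le_sum[of j "{..r}" "\<lambda>j. e j * degree (g j)"] by simp
  moreover have "2 \<le> degree (g j)" using degree_g degree_gi degree_base_ge j(1) by simp
  moreover have "1 * degree (g j) \<le> e j * degree (g j)" using j(2)
    by (intro mult_right_mono) auto
  ultimately show False by simp
qed

text \<open>On the class of \<open>2 * c\<close> the factor \<open>a - 2 * c\<close> is divisible by
  \<open>q\<close>, so \<open>q ^ expo r n i c\<close> divides both summands of
  \<open>poly (g i) a\<close>. The class depends on \<open>a\<close> alone, so one \<open>c\<close>
  serves all \<open>i\<close>.\<close>

lemma cover:
  assumes a: "a \<in> R"
  shows "\<exists>c. \<forall>i\<le>r. int (expo r n i c) \<le> padic q (poly (g i) a)"
proof -
  obtain c y where c: "c < q" "y \<in> R" "a = of_nat (2 * c) + of_nat q * y"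
    by (rule localization_residue[OF prime_q q_gt_2 a])
  have "int (expo r n i c) \<le> padic q (poly (g i) a)" if i: "i \<le> r" for i
  proof -
    let ?E = "expo r n i c"
    define w where "w = y ^ ?E * (\<Prod>c'\<in>{..<q} - {c}. (a - of_nat (2 * c')) ^ expo r n i c') +
      2 * of_nat q ^ (n + 2 - ?E)"
    have nat_R: "of_nat m \<in> R" for m using R_of_int[of "int m"] by simp
    have diff: "a - of_nat m \<in> R" for m
      using R_closed(3)[OF a R_of_int[of "- int m"]] by simp
    have two: "2 \<in> R" using nat_R[of 2] by simp
    have w: "w \<in> R" unfolding w_def
      by (intro R_closed subsemiring_prod[OF subsemiring_R] subsemiring_power[OF subsemiring_R] c(2) diff two nat_R)
    have "n + 2 = ?E + (n + 2 - ?E)" using expo_le[of r n i c] by simp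
    then have q: "(of_nat q :: complex) ^ (n + 2) = of_nat q ^ ?E * of_nat q ^ (n + 2 - ?E)"
      by (metis power_add)
    have "poly (g i) a = (a - of_nat (2 * c)) ^ ?E *
        (\<Prod>c'\<in>{..<q} - {c}. (a - of_nat (2 * c')) ^ expo r n i c') + 2 * of_nat q ^ (n + 2)"
      unfolding g_eval using c(1) by (subst prod.remove[of _ c]) auto
    also have "a - of_nat (2 * c) = of_nat q * y" using c(3) by simp
    finally have eq: "poly (g i) a = of_nat q ^ ?E * w"
      unfolding w_def q by (simp add: power_mult_distrib algebra_simps)
    then have "w \<noteq> 0" using g_nz[OF i a] by auto
    then have "padic q (poly (g i) a) = int ?E + padic q w"
      unfolding eq using w p_nz
      by (simp add: v_mult v_power p_K v_p R_sub_K subsemiring_power[OF subsemiring_K])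
    moreover have "0 \<le> padic q w" using w \<open>w \<noteq> 0\<close>
      by (simp add: localization_def)
    ultimately show ?thesis by simp
  qed
  then show ?thesis by blast
qed

text \<open>At \<open>2 * c\<close> itself the factor for \<open>c\<close> vanishes and could leave
  only the added constant. Shifting by \<open>q\<close> gives this factor the value
  \<open>q\<close>, while the other factors remain prime to \<open>q\<close>.\<close>

lemma attained:
  assumes i: "i \<le> r" and c: "c < 2 * r"
  shows "padic q (poly (g i) (of_nat (2 * c + q))) = int (expo r n i c)"
proof -
  let ?E = "expo r n i c" and ?q = "int q"
  have cq: "c < q" using c q_gt by simp
  have qi: "prime ?q" using prime_q by simp
  define u where "u = (\<Prod>c'\<in>{..<q} - {c}. (2 * (int c - int c') + ?q) ^ expo r n i c')"
  have nd: "\<not> ?q dvd 2 * (int c - int c') + ?q" if "c' < q" "c' \<noteq> c" for c'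
  proof
    assume "?q dvd 2 * (int c - int c') + ?q"
    then have "?q dvd 2 * (int c - int c')" by (simp add: dvd_add_left_iff)
    then have "?q dvd 2 \<or> ?q dvd int c - int c'" by (simp only: prime_dvd_mult_iff[OF qi])
    then show False
    proof
      assume "?q dvd 2"
      then show False using q_gt_2 zdvd_imp_le[of ?q 2] by simp
    next
      assume "?q dvd int c - int c'"
      then show False using that cq dvd_imp_le_int[of "int c - int c'" ?q] by auto
    qed
  qed
  have u: "\<not> ?q dvd u"
  proof
    assume "?q dvd u"
    then have "\<exists>x\<in>{..<q} - {c}. ?q dvd (2 * (int c - int x) + ?q) ^ expo r n i x"
      unfolding u_def by (subst (asm) prime_dvd_prod_iff[OF _ qi]) simp_all
    then obtain x where x: "x \<in> {..<q} - {c}" "?q dvd (2 * (int c - int x) + ?q) ^ expo r n i x"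
      by blast
    then show False using prime_dvd_power[OF qi x(2)] nd[of x] by blast
  qed
  have "n + 2 = ?E + (n + 2 - ?E)" using expo_le[of r n i c] by simp
  then have qE: "?q ^ (n + 2) = ?q ^ ?E * ?q ^ (n + 2 - ?E)" by (metis power_add)
  \<comment> \<open>The exponent is at least \<open>1\<close> by \<open>expo_le\<close>, so the
    second summand is divisible by \<open>q\<close> and cannot cancel the unit part
    \<open>u\<close>.\<close>
  have "?q dvd 2 * ?q ^ (n + 2 - ?E)" using expo_le[of r n i c] by (intro dvd_mult dvd_power) auto
  then have w: "\<not> ?q dvd u + 2 * ?q ^ (n + 2 - ?E)" using u by (simp add: dvd_add_left_iff)
  have "poly (g i) (of_nat (2 * c + q)) =
      of_int ((\<Prod>c'<q. (2 * (int c - int c') + ?q) ^ expo r n i c') + 2 * ?q ^ (n + 2))"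
    by (simp add: g_eval algebra_simps)
  also have "(\<Prod>c'<q. (2 * (int c - int c') + ?q) ^ expo r n i c') = ?q ^ ?E * u"
    unfolding u_def using cq by (subst prod.remove[of _ c]) auto
  also have "?q ^ ?E * u + 2 * ?q ^ (n + 2) = ?q ^ ?E * (u + 2 * ?q ^ (n + 2 - ?E))"
    unfolding qE by (simp add: algebra_simps)
  finally have eq: "poly (g i) (of_nat (2 * c + q)) = of_int (?q ^ ?E * (u + 2 * ?q ^ (n + 2 - ?E)))" .
  have nz: "?q ^ ?E * (u + 2 * ?q ^ (n + 2 - ?E)) \<noteq> 0" using w q_gt_2 by auto
  have "multiplicity ?q (?q ^ ?E * (u + 2 * ?q ^ (n + 2 - ?E))) = ?E"
  proof (rule multiplicity_eqI)
    show "\<not> ?q ^ Suc ?E dvd ?q ^ ?E * (u + 2 * ?q ^ (n + 2 - ?E))"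
      using w q_gt_2 by (simp add: mult.commute[of "int q" "int q ^ _"])
  qed simp
  then show ?thesis unfolding eq padic_of_int[OF prime_q nz] by simp
qed

sublocale pattern "\<rat> :: complex set" "localization q" "of_nat q" "padic q" g "\<lambda>c. of_nat (2 * c + q)" r n
proof
  show "0 < degree (g i)" if "i \<le> r" for i
    using degree_g degree_gi[OF that] degree_base_ge[OF that] by simp
  show "of_nat (2 * c + q) \<in> R" for c using R_of_int[of "int (2 * c + q)"] by simp
qed (use r n g_R g_monic g_nz cover attained divisors in auto)

end

theorem theorem4:
  fixes r n :: nat
  assumes "r \<ge> 2" and "n \<ge> 2"
  shows "\<exists>(K::complex set) R p v f.
     dvr K R p v \<and> finite_residue_field R p \<and>
     f \<in> poly_ring R \<and> primitive_poly R p f \<and> degree f > 0 \<and> vd R v f = n \<and>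
     irred_in (int_val K R) (smult (1 / p ^ n) f) \<and>
     \<not> abs_irred_in (int_val K R) (smult (1 / p ^ n) f) \<and>
     (\<forall>P (W::nat set) A. irr_divisor_set (poly_ring R) f P \<and>
        is_fdp_matrix R v f P W A \<and> rows_indep W P A \<longrightarrow> mat_rank W P A = r) \<and>
     (let S = (LEAST k::nat. k \<ge> 1 \<and>
                 \<not> factors_uniquely_in (int_val K R) ((smult (1 / p ^ n) f) ^ k))
      in S = (n + 1) * ((n - 1) ^ (r - 1) + (n - 1) ^ (r - 2)) \<and>
         (\<forall>P. irr_divisor_set (poly_ring R) f P \<longrightarrow>
            (\<exists>m. m \<in> {pos_norm P u + neg_norm P u | u.
                         u \<in> fdk R v f P \<and> u \<noteq> (\<lambda>_. 0) \<and> (\<forall>g\<in>P. u g \<in> \<int>)} \<and>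
                 (\<forall>u. u \<in> fdk R v f P \<and> u \<noteq> (\<lambda>_. 0) \<and> (\<forall>g\<in>P. u g \<in> \<int>) \<longrightarrow>
                      m \<le> pos_norm P u + neg_norm P u) \<and>
                 rat_of_nat S = rat_of_nat (n + 1) * m)))"
proof -
  obtain q where q: "prime q" "2 * r < q" using bigger_prime by blast
  interpret C: eisenstein_pattern q r n using q assms by unfold_locales
  show ?thesis
    unfolding Let_def
  proof (rule exI[of _ "\<rat>"], rule exI[of _ "localization q"], rule exI[of _ "of_nat q"],
      rule exI[of _ "padic q"], rule exI[of _ C.f], unfold C.F_def[symmetric] C.least_S,
      intro conjI allI impI C.dvr finite_residue_field_localization[OF q(1) C.q_gt_2] C.f_PR
        C.f_primitive C.f_degree C.vd_f C.irred_F C.not_abs_irred_F C.S_def)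
    fix P and W :: "nat set" and A
    assume "irr_divisor_set (poly_ring (localization q)) C.f P \<and>
      is_fdp_matrix (localization q) (padic q) C.f P W A \<and> rows_indep W P A"
    then show "mat_rank W P A = r" by (elim conjE) (rule C.mat_rank_r)
  qed (rule C.minimal_norms_P)
qed

end
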